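(* Let $m\ge1$ and let $l_1\le l_2\le\cdots\le l_m$ be natural numbers; put $L=l_1+\cdots+l_m$ and $\epsilon=\epsilon_m$. Then there exists, for every pair $(\sigma,<)$ where $\sigma$ is a non-crossing pairing compatible with $\epsilon$ and $<$ is a total order on the vertices of $T_\sigma$ compatible with $\prec$, a coloring $\kappa_{\sigma,<}$ of the non-root vertices of $T_\sigma$ by colors from $\{c_1,\dots,c_m\}$, such that $$\sum_{(\sigma,<)} w(\sigma,<,\kappa_{\sigma,<})=S:=\sum_{(s_1,\dots,s_m)}\iota\big[(\underbrace{c_1,\dots,c_1}_{s_1})\big]\cdots\iota\big[(\underbrace{c_{m-1},\dots,c_{m-1}}_{s_{m-1}})\big]\cdot\big[\emptyset\otimes(\underbrace{c_m,\dots,c_m}_{s_m})\big]$$ in $W$, where the sum defining $S$ runs over tuples of non-negative integers with $s_1+\cdots+s_m=L$ and $s_1+\cdots+s_i\le l_1+\cdots+l_i$ for $1\le i\le m-1$.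
   Context: Quotient trees: for an even $k$ and $\epsilon=(\epsilon(1),\dots,\epsilon(k))\in\{\pm1\}^k$, let $G_\epsilon$ be the $k$-gon with vertices $v_1,\dots,v_k$ and edges $e_1,\dots,e_k$, where $e_i$ joins $v_i$ and $v_{i+1}$ ($v_{k+1}=v_1$) and is directed from $v_{i+1}$ to $v_i$ if $\epsilon(i)=+1$ and from $v_i$ to $v_{i+1}$ if $\epsilon(i)=-1$. A pairing $\sigma$ of $\{1,\dots,k\}$ is compatible with $\epsilon$ if $\epsilon(i)+\epsilon(j)=0$ for all $\{i,j\}\in\sigma$, and non-crossing if there are no $p<q<s<t$ with $\{p,s\},\{q,t\}\in\sigma$. For such $\sigma$, $T_\sigma$ is obtained by gluing, for each $\{i,j\}\in\sigma$, edge $e_i$ to $e_j$ with $v_i$ identified with $v_{j+1}$ and $v_{i+1}$ with $v_j$; it is a directed tree (orientations are inherited consistently), rooted at the class $r$ of $v_1$. Write $a\prec b$ if there is a directed path from $b$ to $a$; a total order $<$ on the vertices is compatible with $\prec$ if $a\prec b$ implies $a<b$. The sequence $\epsilon_m$ is $\big(\underbrace{+1}_{l_m},\underbrace{-1}_{l_{m-1}},\dots,\underbrace{(-1)^{m-1}}_{l_1},\underbrace{(-1)^{m}}_{l_1},\underbrace{(-1)^{m-1}}_{l_2},\dots,\underbrace{-1}_{l_m}\big)$, where $\underbrace{x}_{j}$ means $x$ repeated $j$ times; it has length $2L$. Words: let $W$ be the free abelian group on symbols $A\otimes B$ where $A,B$ are finite words (possibly empty, written $\emptyset$) over the alphabet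 $\{c_1,\dots,c_m\}$; $A\otimes B$ stands for the word $A$, then $r$, then $B$. For words $A,C$ of lengths $p,q$, let $AC$ be the formal sum of the $\binom{p+q}{p}$ interleavings of $A$ and $C$ (counted with multiplicity, internal orders preserved); $W$ carries the bilinear product $(A\otimes B)(C\otimes D)=(AC)\otimes(BD)$. For a word $(a_1,\dots,a_n)$ set $\iota(a_1,\dots,a_n)=\sum_{k=0}^n(a_1,\dots,a_k)\otimes(a_{k+1},\dots,a_n)\in W$. Given $(\sigma,<)$ and a coloring $\kappa$ of non-root vertices of $T_\sigma$, $w(\sigma,<,\kappa)\in W$ is the word obtained by listing the vertices of $T_\sigma$ in increasing $<$-order, writing $r$ for the root and $\kappa(v)$ for every other vertex $v$. For $m=1$ the product of $\iota$-factors in $S$ is empty. *)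

theory Defs
  imports "HOL-Library.Poly_Mapping" "HOL-Library.Multiset" "HOL-Library.Disjoint_Sets"
    "HOL-Library.FuncSet"
begin

text \<open>
  A sequence of signs is an integer list \<open>e\<close> of length \<open>k\<close>, so that the
  sign with (1-based) index \<open>i\<close> is \<open>e ! (i - 1)\<close>.  The vertex \<open>v_i\<close> and the edge \<open>e_i\<close>
  of the \<open>k\<close>-gon are represented by the number \<open>i\<close>.  The degenerate polygon with
  \<open>k = 0\<close> has the single vertex \<open>v_1\<close> and no edges.
\<close>

definition sign :: "int list \<Rightarrow> nat \<Rightarrow> int" where
  "sign e i = e ! (i - 1)"

definition polygon_verts :: "nat \<Rightarrow> nat set" where
  "polygon_verts k = {1..max 1 k}"

definition next_vert :: "nat \<Rightarrow> nat \<Rightarrow> nat" where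
  "next_vert k i = (if i = k then 1 else i + 1)"

definition is_pairing :: "nat \<Rightarrow> nat set set \<Rightarrow> bool" where
  "is_pairing k \<sigma> \<longleftrightarrow> partition_on {1..k} \<sigma> \<and> (\<forall>B\<in>\<sigma>. card B = 2)"

definition compatible_pairing :: "int list \<Rightarrow> nat set set \<Rightarrow> bool" where
  "compatible_pairing e \<sigma> \<longleftrightarrow> (\<forall>i j. {i, j} \<in> \<sigma> \<longrightarrow> sign e i + sign e j = 0)"

definition noncrossing :: "nat set set \<Rightarrow> bool" where
  "noncrossing \<sigma> \<longleftrightarrow>
     \<not> (\<exists>p q s t. p < q \<and> q < s \<and> s < t \<and> {p, s} \<in> \<sigma> \<and> {q, t} \<in> \<sigma>)"

text \<open>
  As \<open>{i, j} = {j, i}\<close>, the set \<open>glued_pairs\<close> contains, for each pair, both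
  \<open>(v_i, v_(j+1))\<close> and \<open>(v_j, v_(i+1))\<close>.
\<close>

definition glued_pairs :: "nat \<Rightarrow> nat set set \<Rightarrow> nat rel" where
  "glued_pairs k \<sigma> = {(i, next_vert k j) | i j. {i, j} \<in> \<sigma>}"

definition glue_rel :: "nat \<Rightarrow> nat set set \<Rightarrow> nat rel" where
  "glue_rel k \<sigma> = Restr ((glued_pairs k \<sigma> \<union> (glued_pairs k \<sigma>)\<inverse>)\<^sup>*) (polygon_verts k)"

definition vclass :: "nat \<Rightarrow> nat set set \<Rightarrow> nat \<Rightarrow> nat set" where
  "vclass k \<sigma> i = glue_rel k \<sigma> `` {i}"

definition tree_verts :: "int list \<Rightarrow> nat set set \<Rightarrow> nat set set" where
  "tree_verts e \<sigma> = polygon_verts (length e) // glue_rel (length e) \<sigma>"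

definition tree_root :: "int list \<Rightarrow> nat set set \<Rightarrow> nat set" where
  "tree_root e \<sigma> = vclass (length e) \<sigma> 1"

text \<open>A pair \<open>(a, b)\<close> in \<open>tree_edges\<close> is an edge directed from \<open>a\<close> to \<open>b\<close>.\<close>

definition tree_edges :: "int list \<Rightarrow> nat set set \<Rightarrow> (nat set) rel" where
  "tree_edges e \<sigma> =
     (let k = length e in
       {(vclass k \<sigma> (next_vert k i), vclass k \<sigma> i) | i. i \<in> {1..k} \<and> sign e i = 1} \<union>
       {(vclass k \<sigma> i, vclass k \<sigma> (next_vert k i)) | i. i \<in> {1..k} \<and> sign e i = -1})"

definition tree_prec :: "int list \<Rightarrow> nat set set \<Rightarrow> nat set \<Rightarrow> nat set \<Rightarrow> bool" where
  "tree_prec e \<sigma> a b \<longleftrightarrow> (b, a) \<in> (tree_edges e \<sigma>)\<^sup>+"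

text \<open>
  A total order on the vertices is its strict part \<open>R\<close>: \<open>(a, b) \<in> R\<close> means \<open>a < b\<close>.
  The inclusion in \<open>V \<times> V\<close> ensures that each order is counted only once.
\<close>

definition compatible_order :: "int list \<Rightarrow> nat set set \<Rightarrow> (nat set) rel \<Rightarrow> bool" where
  "compatible_order e \<sigma> R \<longleftrightarrow>
     R \<subseteq> tree_verts e \<sigma> \<times> tree_verts e \<sigma> \<and>
     strict_linear_order_on (tree_verts e \<sigma>) R \<and>
     (\<forall>a\<in>tree_verts e \<sigma>. \<forall>b\<in>tree_verts e \<sigma>. tree_prec e \<sigma> a b \<longrightarrow> (a, b) \<in> R)"

definition ordered_pairings :: "int list \<Rightarrow> (nat set set \<times> (nat set) rel) set" where
  "ordered_pairings e =
     {(\<sigma>, R). is_pairing (length e) \<sigma> \<and> compatible_pairing e \<sigma> \<and> noncrossing \<sigma> \<and>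
               compatible_order e \<sigma> R}"

definition eps_seq :: "nat \<Rightarrow> (nat \<Rightarrow> nat) \<Rightarrow> int list" where
  "eps_seq m l =
     concat (map (\<lambda>i. replicate (l i) ((-1) ^ (m - i))) (rev [1..<m + 1])) @
     concat (map (\<lambda>i. replicate (l i) ((-1) ^ (m - i + 1))) [1..<m + 1])"

text \<open>
  The color \<open>c_i\<close> is the number \<open>i\<close>, and the symbol \<open>A \<otimes> B\<close> is the pair \<open>(A, B)\<close>.
  The group is free on all pairs of words over the naturals; the group of words over
  \<open>{1..m}\<close> is the subgroup spanned by the corresponding pairs.
\<close>

type_synonym word_group = "(nat list \<times> nat list) \<Rightarrow>\<^sub>0 int"

fun interleavings :: "'a list \<Rightarrow> 'a list \<Rightarrow> 'a list multiset" where
  "interleavings [] ys = {#ys#}"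
| "interleavings xs [] = {#xs#}"
| "interleavings (x # xs) (y # ys) =
     image_mset ((#) x) (interleavings xs (y # ys)) +
     image_mset ((#) y) (interleavings (x # xs) ys)"

definition basis_mult :: "nat list \<times> nat list \<Rightarrow> nat list \<times> nat list \<Rightarrow> word_group" where
  "basis_mult u v =
     (\<Sum>E\<in>#interleavings (fst u) (fst v). \<Sum>F\<in>#interleavings (snd u) (snd v). frag_of (E, F))"

definition word_mult :: "word_group \<Rightarrow> word_group \<Rightarrow> word_group"  (infixr "\<star>" 70) where
  "x \<star> y = frag_extend (\<lambda>u. frag_extend (\<lambda>v. basis_mult u v) y) x"

definition word_iota :: "nat list \<Rightarrow> word_group" where
  "word_iota as = (\<Sum>k=0..length as. frag_of (take k as, drop k as))"

definition tuples :: "nat \<Rightarrow> (nat \<Rightarrow> nat) \<Rightarrow> (nat \<Rightarrow> nat) set" where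
  "tuples m l =
     {s \<in> extensional {1..m}.
        (\<Sum>i=1..m. s i) = (\<Sum>i=1..m. l i) \<and>
        (\<forall>i\<in>{1..m - 1}. (\<Sum>j=1..i. s j) \<le> (\<Sum>j=1..i. l j))}"

definition word_S :: "nat \<Rightarrow> (nat \<Rightarrow> nat) \<Rightarrow> word_group" where
  "word_S m l =
     (\<Sum>s\<in>tuples m l.
        foldr (\<star>) (map (\<lambda>i. word_iota (replicate (s i) i)) [1..<m])
          (frag_of ([], replicate (s m) m)))"

definition increasing_list :: "'a set \<Rightarrow> 'a rel \<Rightarrow> 'a list" where
  "increasing_list V R =
     (THE xs. set xs = V \<and> distinct xs \<and> sorted_wrt (\<lambda>a b. (a, b) \<in> R) xs)"

definition tree_word ::
    "int list \<Rightarrow> nat set set \<Rightarrow> (nat set) rel \<Rightarrow> (nat set \<Rightarrow> nat) \<Rightarrow> word_group" where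
  "tree_word e \<sigma> R \<kappa> =
     (let xs = increasing_list (tree_verts e \<sigma>) R; r = tree_root e \<sigma> in
       frag_of (map \<kappa> (takeWhile (\<lambda>v. v \<noteq> r) xs), map \<kappa> (tl (dropWhile (\<lambda>v. v \<noteq> r) xs))))"

lemma interleavings_Nil2 [simp]: "interleavings xs [] = {#xs#}"
  by (cases xs) auto

lemma size_interleavings:
  "size (interleavings xs ys) = (length xs + length ys) choose length xs"
  by (induction xs ys rule: interleavings.induct) auto

lemma word_mult_basis: "frag_of u \<star> frag_of v = basis_mult u v"
  by (simp add: word_mult_def)

lemma length_eps_seq: "length (eps_seq m l) = 2 * (\<Sum>i=1..m. l i)"
proof -
  have "sum_list (map l [1..<m + 1]) = (\<Sum>i=1..m. l i)"
    by (metis Suc_eq_plus1 atLeastLessThanSuc_atLeastAtMost distinct_upt set_upt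
        sum.distinct_set_conv_list)
  then show ?thesis
    by (simp add: eps_seq_def length_concat comp_def rev_map[symmetric] del: upt_Suc)
qed

lemma finite_tree_verts: "finite (tree_verts e \<sigma>)"
  by (auto simp: tree_verts_def polygon_verts_def quotient_def)

lemma tree_root_in_tree_verts: "tree_root e \<sigma> \<in> tree_verts e \<sigma>"
  by (auto simp: tree_root_def tree_verts_def vclass_def polygon_verts_def intro: quotientI)

lemma finite_ordered_pairings: "finite (ordered_pairings e)"
proof (rule finite_subset)
  show "ordered_pairings e \<subseteq>
      (SIGMA \<sigma>:{\<sigma>. partition_on {1..length e} \<sigma>}. Pow (tree_verts e \<sigma> \<times> tree_verts e \<sigma>))"
    by (auto simp: ordered_pairings_def is_pairing_def compatible_order_def)
  show "finite \<dots>"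
    by (intro finite_SigmaI finitely_many_partition_on) (auto simp: finite_tree_verts)
qed

lemma finite_tuples: "finite (tuples m l)"
proof (rule finite_subset)
  show "tuples m l \<subseteq> PiE {1..m} (\<lambda>_. {..\<Sum>i=1..m. l i})"
  proof
    fix s assume s: "s \<in> tuples m l"
    have "s i \<le> (\<Sum>i=1..m. l i)" if "i \<in> {1..m}" for i
      using member_le_sum[of i "{1..m}" s] s that by (auto simp: tuples_def)
    then show "s \<in> PiE {1..m} (\<lambda>_. {..\<Sum>i=1..m. l i})"
      using s by (auto simp: tuples_def PiE_def)
  qed
qed (auto intro: finite_PiE)

lemma increasing_list_ex1:
  assumes "finite V" "strict_linear_order_on V R"
  shows "\<exists>!xs. set xs = V \<and> distinct xs \<and> sorted_wrt (\<lambda>a b. (a, b) \<in> R) xs"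
  using assms
proof (induction V rule: finite_psubset_induct)
  case (psubset V)
  have tr: "trans R" and ir: "irrefl R" and tot: "total_on V R"
    using psubset.prems by (auto simp: strict_linear_order_on_def)
  show ?case
  proof (cases "V = {}")
    case True
    then show ?thesis by auto
  next
    case False
    have "\<exists>a\<in>V. \<forall>b\<in>V. b \<noteq> a \<longrightarrow> (a, b) \<in> R"
      using psubset.hyps(1) False tot
    proof (induction V rule: finite_ne_induct)
      case (insert x F)
      then obtain a where a: "a \<in> F" "\<forall>b\<in>F. b \<noteq> a \<longrightarrow> (a, b) \<in> R"
        by (auto simp: total_on_def)
      have "(a, x) \<in> R \<or> (x, a) \<in> R"
        using insert.prems insert.hyps a by (auto simp: total_on_def)
      then show ?case
        using a tr by (metis insert_iff transD)
    qed auto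
    then obtain a where a: "a \<in> V" "\<And>b. b \<in> V \<Longrightarrow> b \<noteq> a \<Longrightarrow> (a, b) \<in> R" by blast
    have "strict_linear_order_on (V - {a}) R"
      using tr ir tot by (auto simp: strict_linear_order_on_def total_on_def)
    then have ex1: "\<exists>!xs. set xs = V - {a} \<and> distinct xs \<and> sorted_wrt (\<lambda>a b. (a, b) \<in> R) xs"
      using psubset.IH[of "V - {a}"] a(1) by blast
    then obtain xs where xs: "set xs = V - {a}" "distinct xs" "sorted_wrt (\<lambda>a b. (a, b) \<in> R) xs"
      by blast
    show ?thesis
    proof (rule ex1I[of _ "a # xs"])
      show "set (a # xs) = V \<and> distinct (a # xs) \<and> sorted_wrt (\<lambda>a b. (a, b) \<in> R) (a # xs)"
        using xs a by auto
      fix ys assume ys: "set ys = V \<and> distinct ys \<and> sorted_wrt (\<lambda>a b. (a, b) \<in> R) ys"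
      then obtain z zs where z: "ys = z # zs" using a(1) by (cases ys) auto
      have "z = a"
      proof (rule ccontr)
        assume "z \<noteq> a"
        then have "(z, a) \<in> R" "(a, z) \<in> R" using ys z a by auto
        then show False using tr ir by (meson irrefl_def transD)
      qed
      moreover have "zs = xs"
        using ex1 xs ys z \<open>z = a\<close> by (metis Diff_insert_absorb distinct.simps(2) list.simps(15)
          sorted_wrt.simps(2))
      ultimately show "ys = a # xs" using z by simp
    qed
  qed
qed

end

(*
  The coloring may be chosen freely for every (sigma, <), so only the number of pairs (sigma, <)
  with a given number of vertices below the root matters. In exponential generating functions, with
  X^p Y^q / (p! q!) for p vertices below and q above the root, this number is the volume of
  the order polytope of T_sigma with the root fixed at distance Y from the top and X from the
  bottom of an interval of length h = X + Y. Summed over all sigma, these volumes form a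
  noncommutative power series P in the letters a = +1, b = -1, and the decomposition at the first
  edge of the polygon gives P' = P (a P b - b P a) P, where ' is the derivative in y = Y.

  Let w = a + b. Since a P b - b P a = a P w - w P a, the derivative of R_n = P (w P)^n telescopes
  to P a R_(n+1) - R_(n+1) a P. On words with nonnegative partial sums this is R_(n+2), on words
  with nonpositive partial sums it is -R_(n+2). At y = 0 the root is the top vertex, so P vanishes
  on words that start with a or end with b; hence the coefficient of R_(n+2) at a v b is
  that of R_n at v. Thus the k-th derivative of P at a^k v b^k is P at v with y replaced by -y.
  For v = -eps_(m-1) and k = l_m this is a recursion in m, where l_(m-1) <= l_m ensures the
  sign conditions; the right-hand side satisfies the same recursion.
*)
theory Submission
  imports Defs Complex_Main "HOL-Computational_Algebra.Polynomial"
begin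

section \<open>Noncommutative power series\<close>


text \<open>Cutting a contour at the return of its first edge leads out of the family
  \<open>eps_seq m l\<close>, so the volumes of all words are collected in one series. Trees enter
  it only through an equation P = 1 + K P with K' = a P b - b P a; formally P = (1 - K)^(-1), whence
  P' = P K' P. Higher derivatives of P involve ever more factors. The series R_n tame them: on words
  whose partial sums have one sign, each derivative merely adds two selected letters, so polynomials
  can be compared through their Taylor coefficients at 0. At that point the outer letters are forced
  to be selected, and the remaining selections are read back as derivatives of the inner word.
  Reversing all arrows replaces y by h - y, so the inner derivatives at 0 become derivatives at h
  for the previous sequence. Back from volumes to words: every word in S has L letters besides r and
  a nonnegative multiplicity, so S is a multiset. As h is arbitrary, X and Y are independent and
  each root position can be counted separately; words are then matched with pairs having the same
  root position.\<close>

datatype 'a nc_series = NC_Series (nc_coeff: "int list \<Rightarrow> 'a")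

lemma nc_series_eqI: "(\<And>w. nc_coeff x w = nc_coeff y w) \<Longrightarrow> x = y"
  by (cases x; cases y) auto

instantiation nc_series :: (ring_1) ring_1
begin

definition "0 = NC_Series (\<lambda>_. 0)"
definition "1 = NC_Series (\<lambda>w. if w = [] then 1 else 0)"
definition "x + y = NC_Series (\<lambda>w. nc_coeff x w + nc_coeff y w)"
definition "x - y = NC_Series (\<lambda>w. nc_coeff x w - nc_coeff y w)"
definition "- x = NC_Series (\<lambda>w. - nc_coeff x w)"
definition "x * y =
  NC_Series (\<lambda>w. \<Sum>i\<le>length w. nc_coeff x (take i w) * nc_coeff y (drop i w))"

lemma nc_coeff_simps [simp]:
  "nc_coeff 0 w = (0 :: 'a)"
  "nc_coeff 1 w = (if w = [] then 1 else 0 :: 'a)"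
  "nc_coeff (x + y) w = nc_coeff x w + (nc_coeff y w :: 'a)"
  "nc_coeff (x - y) w = nc_coeff x w - (nc_coeff y w :: 'a)"
  "nc_coeff (- x) w = - (nc_coeff x w :: 'a)"
  by (simp_all add: zero_nc_series_def one_nc_series_def plus_nc_series_def minus_nc_series_def
      uminus_nc_series_def)

lemma nc_coeff_mult:
  "nc_coeff (x * y) w =
     (\<Sum>i\<le>length w. nc_coeff x (take i w) * (nc_coeff y (drop i w) :: 'a))"
  by (simp add: times_nc_series_def)

instance
proof
  fix x y z :: "'a nc_series"
  show "x * y * z = x * (y * z)"
  proof (rule nc_series_eqI)
    fix w :: "int list"
    let ?n = "length w"
    let ?t = "\<lambda>i j. nc_coeff x (take j w) * nc_coeff y (take (i - j) (drop j w)) *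
                 nc_coeff z (drop i w)"
    have "nc_coeff (x * y * z) w = (\<Sum>i\<le>?n. \<Sum>j\<le>i. ?t i j)"
      by (simp add: nc_coeff_mult sum_distrib_right min_absorb1 min_absorb2 drop_take)
    also have "\<dots> = (\<Sum>(i, j)\<in>(SIGMA i:{..?n}. {..i}). ?t i j)"
      by (rule sum.Sigma) auto
    also have "\<dots> = (\<Sum>(j, k)\<in>(SIGMA j:{..?n}. {..?n - j}). ?t (j + k) j)"
      by (rule sum.reindex_bij_witness[of _ "\<lambda>(j, k). (j + k, j)" "\<lambda>(i, j). (j, i - j)"]) auto
    also have "\<dots> = (\<Sum>j\<le>?n. \<Sum>k\<le>?n - j. ?t (j + k) j)"
      by (rule sum.Sigma[symmetric]) auto
    also have "\<dots> = nc_coeff (x * (y * z)) w"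
      by (simp add: nc_coeff_mult sum_distrib_left mult.assoc add.commute)
    finally show "nc_coeff (x * y * z) w = nc_coeff (x * (y * z)) w" .
  qed
  have if_0: "(\<Sum>i\<le>length w. if i = 0 \<or> w = [] then f i else 0) = f 0"
    for w :: "int list" and f :: "nat \<Rightarrow> 'a"
    by (cases "w = []") simp_all
  have if_n: "(\<Sum>i\<le>length w. if length w \<le> i then f i else 0) = f (length w)"
    for w :: "int list" and f :: "nat \<Rightarrow> 'a"
    by (subst sum.cong[OF refl, where h = "\<lambda>i. if i = length w then f i else 0"]) auto
  show "1 * x = x"
    by (rule nc_series_eqI) (simp add: nc_coeff_mult if_distrib[of "\<lambda>a. a * _"] if_0 cong: if_cong)
  show "x * 1 = x"
    by (rule nc_series_eqI) (simp add: nc_coeff_mult if_distrib[of "\<lambda>a. _ * a"] if_n cong: if_cong)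
  show "(x + y) * z = x * z + y * z" "x * (y + z) = x * y + x * z"
    by (auto intro!: nc_series_eqI simp: nc_coeff_mult algebra_simps sum.distrib)
  show "(0 :: 'a nc_series) \<noteq> 1"
    by (metis nc_coeff_simps(1,2) zero_neq_one)
qed (auto intro!: nc_series_eqI simp: algebra_simps)

end

definition letter :: "int \<Rightarrow> 'a :: ring_1 nc_series" where
  "letter s = NC_Series (\<lambda>w. if w = [s] then 1 else 0)"

lemma nc_coeff_letter_mult:
  "nc_coeff (letter s * x) w = (if w \<noteq> [] \<and> hd w = s then nc_coeff x (tl w) else 0)"
proof (cases w)
  case (Cons c v)
  have "nc_coeff (letter s) (take i w) * nc_coeff x (drop i w) =
      (if i = Suc 0 then (if c = s then nc_coeff x v else 0) else 0)" if "i \<le> length w" for i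
    using Cons that by (cases i; cases "i - 1"; cases v) (auto simp: letter_def)
  then have "nc_coeff (letter s * x) w =
    (\<Sum>i\<le>length w. if i = Suc 0 then (if c = s then nc_coeff x v else 0) else 0)"
    unfolding nc_coeff_mult by simp
  also have "\<dots> = (if c = s then nc_coeff x v else 0)"
    by (subst sum.delta) (auto simp: Cons)
  finally show ?thesis by (simp add: Cons)
qed (simp add: nc_coeff_mult letter_def)

lemma nc_coeff_mult_letter:
  "nc_coeff (x * letter s) w =
     (if w \<noteq> [] \<and> last w = s then nc_coeff x (butlast w) else 0)"
proof (cases w rule: rev_cases)
  case (snoc v c)
  have "nc_coeff x (take i w) * nc_coeff (letter s) (drop i w) =
      (if i = length v then (if c = s then nc_coeff x v else 0) else 0)"
    if le: "i \<le> Suc (length v)" for i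
  proof -
    consider "i < length v" | "i = length v" | "i = Suc (length v)"
      using le by linarith
    then show "nc_coeff x (take i w) * nc_coeff (letter s) (drop i w) =
      (if i = length v then (if c = s then nc_coeff x v else 0) else 0)"
    proof cases
      case 1
      then have "drop i w \<noteq> [s]"
        using snoc by (metis length_append_singleton length_drop length_Cons list.size(3) diff_is_0_eq
            Suc_diff_le less_imp_le_nat not_less nat.inject)
      with 1 show ?thesis by (simp add: letter_def)
    qed (auto simp: snoc letter_def)
  qed
  then have "nc_coeff (x * letter s) w =
    (\<Sum>i\<le>length w. if i = length v then (if c = s then nc_coeff x v else 0) else 0)"
    unfolding nc_coeff_mult using snoc by (intro sum.cong) auto
  with snoc show ?thesis by simp
qed (simp add: nc_coeff_mult letter_def)

lemma nc_coeff_mult_nz: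
  assumes "nc_coeff (x * y) w \<noteq> 0"
  obtains u v where "w = u @ v" "nc_coeff x u \<noteq> 0" "nc_coeff y v \<noteq> 0"
proof -
  from assms obtain i where "nc_coeff x (take i w) * nc_coeff y (drop i w) \<noteq> 0"
    unfolding nc_coeff_mult by (metis (no_types, lifting) sum.neutral)
  then have "nc_coeff x (take i w) \<noteq> 0" "nc_coeff y (drop i w) \<noteq> 0"
    by (metis mult_zero_left, metis mult_zero_right)
  then show thesis
    using that[of "take i w" "drop i w"] by simp
qed

text \<open>A series without constant term is topologically nilpotent.\<close>

lemma nc_series_fixed_point_0:
  assumes "nc_coeff k [] = 0" "z = k * z"
  shows "z = 0"
proof (rule nc_series_eqI)
  fix w
  show "nc_coeff z w = nc_coeff 0 w"
  proof (induction w rule: length_induct)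
    case (1 w)
    have "nc_coeff (k * z) w = 0"
      unfolding nc_coeff_mult
    proof (rule sum.neutral, rule ballI)
      fix i assume "i \<in> {..length w}"
      show "nc_coeff k (take i w) * nc_coeff z (drop i w) = 0"
        using 1 assms(1) by (cases "i = 0 \<or> w = []") auto
    qed
    then show ?case using assms(2) by simp
  qed
qed

definition nc_deriv :: "'a poly nc_series \<Rightarrow> 'a :: idom poly nc_series" where
  "nc_deriv x = NC_Series (\<lambda>w. pderiv (nc_coeff x w))"

lemma nc_coeff_deriv [simp]: "nc_coeff (nc_deriv x) w = pderiv (nc_coeff x w)"
  by (simp add: nc_deriv_def)

lemma nc_deriv_simps:
  "nc_deriv 1 = 0"
  "nc_deriv (letter s) = 0"
  "nc_deriv (x + y) = nc_deriv x + nc_deriv y"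
  "nc_deriv (x * y) = nc_deriv x * y + x * nc_deriv y"
  by (auto intro!: nc_series_eqI simp: pderiv_add letter_def nc_coeff_mult pderiv_mult sum.distrib
      higher_pderiv_sum[of 1, simplified] add.commute mult.commute)

section \<open>Volumes of contour words\<close>


text \<open>Plane trees with directed edges, in first-child form: \<open>Node b s t\<close> joins
  the root of \<open>t\<close> to a new first child, the root of \<open>s\<close>. The child lies
  above the root if \<open>b\<close> holds, matching the direction of an edge with sign +1.\<close>

datatype ptree = Leaf | Node bool ptree ptree

definition sgn_of :: "bool \<Rightarrow> int" where
  "sgn_of b = (if b then 1 else -1)"

fun contour :: "ptree \<Rightarrow> int list" where
  "contour Leaf = []"
| "contour (Node b s t) = sgn_of b # contour s @ - sgn_of b # contour t"

definition ptrees :: "int list \<Rightarrow> ptree set" where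
  "ptrees w = {t. contour t = w}"

lemma ptrees_Nil: "ptrees [] = {Leaf}"
proof -
  have "contour t = [] \<longleftrightarrow> t = Leaf" for t by (cases t) auto
  then show ?thesis by (auto simp: ptrees_def)
qed

text \<open>The index \<open>i\<close> is the position in \<open>v\<close> at which the walk around
  the tree returns along its first edge.\<close>

lemma ptrees_Cons:
  "ptrees (sgn_of b # v) =
     (\<Union>i\<in>{i. i < length v \<and> v ! i = - sgn_of b}.
        (\<lambda>(s, t). Node b s t) ` (ptrees (take i v) \<times> ptrees (drop (Suc i) v)))"
    (is "_ = ?A")
proof (rule set_eqI)
  fix u
  show "u \<in> ptrees (sgn_of b # v) \<longleftrightarrow> u \<in> ?A"
  proof
    assume "u \<in> ptrees (sgn_of b # v)"
    then obtain s t where st: "u = Node b s t" "v = contour s @ - sgn_of b # contour t"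
      by (cases u) (auto simp: ptrees_def sgn_of_def split: if_splits)
    then have "length (contour s) \<in> {i. i < length v \<and> v ! i = - sgn_of b}"
      "s \<in> ptrees (take (length (contour s)) v)" "t \<in> ptrees (drop (Suc (length (contour s))) v)"
      by (auto simp: ptrees_def)
    with st(1) show "u \<in> ?A" by blast
  next
    assume "u \<in> ?A"
    then show "u \<in> ptrees (sgn_of b # v)"
      by (auto simp: ptrees_def id_take_nth_drop[symmetric]) (metis id_take_nth_drop)
  qed
qed

lemma ptrees_Cons_0: "s \<noteq> 1 \<Longrightarrow> s \<noteq> -1 \<Longrightarrow> ptrees (s # v) = {}"
proof -
  assume "s \<noteq> 1" "s \<noteq> -1"
  then have "contour t \<noteq> s # v" for t by (cases t) (auto simp: sgn_of_def)
  then show ?thesis by (auto simp: ptrees_def)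
qed

lemma finite_ptrees: "finite (ptrees w)"
proof (induction w rule: length_induct)
  case (1 w)
  show ?case
  proof (cases w)
    case (Cons c v)
    show ?thesis
    proof (cases "\<exists>b. c = sgn_of b")
      case True
      then show ?thesis using 1 Cons by (auto simp: ptrees_Cons)
    next
      case False
      then have "c \<noteq> 1" "c \<noteq> -1" by (auto simp: sgn_of_def split: if_splits)
      then show ?thesis using Cons ptrees_Cons_0 by simp
    qed
  qed (simp add: ptrees_Nil)
qed

definition antideriv :: "real poly \<Rightarrow> real poly" where
  "antideriv p = (\<Sum>i\<le>degree p. monom (coeff p i / Suc i) (Suc i))"

lemma coeff_antideriv: "coeff (antideriv p) n = (if n = 0 then 0 else coeff p (n - 1) / n)"
proof (cases n)
  case (Suc k)
  have "coeff (antideriv p) n = (\<Sum>i\<le>degree p. if i = k then coeff p i / Suc i else 0)"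
    unfolding antideriv_def coeff_sum by (intro sum.cong) (auto simp: Suc)
  also have "\<dots> = coeff p k / Suc k"
    by (auto simp: coeff_eq_0)
  finally show ?thesis by (simp add: Suc)
qed (simp add: antideriv_def coeff_sum)

lemma pderiv_antideriv [simp]: "pderiv (antideriv p) = p"
  by (rule poly_eqI) (simp add: coeff_pderiv coeff_antideriv field_simps del: of_nat_Suc)

lemma poly_antideriv_0 [simp]: "poly (antideriv p) 0 = 0"
  by (simp add: poly_0_coeff_0 coeff_antideriv)

lemma antideriv_add: "antideriv (p + q) = antideriv p + antideriv q"
  by (rule poly_eqI) (simp add: coeff_antideriv add_divide_distrib)

lemma antideriv_0 [simp]: "antideriv 0 = 0"
  by (rule poly_eqI) (simp add: coeff_antideriv)

lemma antideriv_unique: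
  assumes "pderiv q = p"
  shows "antideriv p = q - [:poly q 0:]"
proof (rule poly_eqI)
  fix n
  show "coeff (antideriv p) n = coeff (q - [:poly q 0:]) n"
    using assms by (cases n) (auto simp: coeff_antideriv coeff_pderiv poly_0_coeff_0 field_simps
        simp del: of_nat_Suc)
qed

text \<open>
  The variable \<open>y\<close> is the distance of the root to the top of an interval of length \<open>h\<close>.
  The other end of an edge at the root is integrated over the part above or below it.
\<close>

definition edge_int :: "real \<Rightarrow> bool \<Rightarrow> real poly \<Rightarrow> real poly" where
  "edge_int h b p = (if b then antideriv p else [:poly (antideriv p) h:] - antideriv p)"

lemma edge_int_0 [simp]: "edge_int h b 0 = 0"
  by (simp add: edge_int_def)

lemma edge_int_add: "edge_int h b (p + q) = edge_int h b p + edge_int h b q"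
  by (auto simp: edge_int_def antideriv_add)

lemma edge_int_sum: "edge_int h b (sum f A) = (\<Sum>x\<in>A. edge_int h b (f x))"
  by (induction A rule: infinite_finite_induct) (simp_all add: edge_int_add)

lemma pderiv_edge_int: "pderiv (edge_int h b p) = (if b then p else - p)"
  by (simp add: edge_int_def pderiv_diff pderiv_pCons)

text \<open>One boundary value fixes the antiderivative: a child above the root has no room at y =
  0, a child below it has none at y = h.\<close>

lemma edge_int_unique:
  assumes "pderiv q = (if b then p else - p)" "poly q (if b then 0 else h) = 0"
  shows "edge_int h b p = q"
proof (cases b)
  case True
  then show ?thesis
    using antideriv_unique[of q p] assms by (simp add: edge_int_def)
next
  case False
  then have *: "antideriv p = - q - [:poly (- q) 0:]"
    using antideriv_unique[of "- q" p] assms(1) by (simp add: pderiv_minus)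
  show ?thesis
    using False assms(2) unfolding edge_int_def * by simp
qed

text \<open>With the root fixed, the branches at the root are independent, so their volumes
  multiply; the child of the first branch is integrated over its allowed part of the
  interval.\<close>

fun tree_volume :: "real \<Rightarrow> ptree \<Rightarrow> real poly" where
  "tree_volume h Leaf = 1"
| "tree_volume h (Node b s t) = edge_int h b (tree_volume h s) * tree_volume h t"

definition word_volume :: "real \<Rightarrow> int list \<Rightarrow> real poly" where
  "word_volume h w = (\<Sum>t\<in>ptrees w. tree_volume h t)"

lemma word_volume_Nil [simp]: "word_volume h [] = 1"
  by (simp add: word_volume_def ptrees_Nil)

lemma word_volume_Cons:
  "word_volume h (sgn_of b # v) =
     (\<Sum>i | i < length v \<and> v ! i = - sgn_of b.
        edge_int h b (word_volume h (take i v)) * word_volume h (drop (Suc i) v))"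
proof -
  have len: "length (contour s) = i" if "s \<in> ptrees (take i v)" "i < length v" for i s
    using that by (simp add: ptrees_def)
  have "word_volume h (sgn_of b # v) =
     (\<Sum>i | i < length v \<and> v ! i = - sgn_of b.
        \<Sum>t\<in>(\<lambda>(s, t). Node b s t) ` (ptrees (take i v) \<times> ptrees (drop (Suc i) v)).
          tree_volume h t)"
    unfolding word_volume_def ptrees_Cons
  proof (rule sum.UNION_disjoint)
    show "\<forall>i\<in>{i. i < length v \<and> v ! i = - sgn_of b}.
        \<forall>j\<in>{i. i < length v \<and> v ! i = - sgn_of b}. i \<noteq> j \<longrightarrow>
        (\<lambda>(s, t). Node b s t) ` (ptrees (take i v) \<times> ptrees (drop (Suc i) v)) \<inter>
        (\<lambda>(s, t). Node b s t) ` (ptrees (take j v) \<times> ptrees (drop (Suc j) v)) = {}"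
      by (auto dest!: len)
  qed (auto simp: finite_ptrees)
  also have "\<dots> = (\<Sum>i | i < length v \<and> v ! i = - sgn_of b.
        edge_int h b (word_volume h (take i v)) * word_volume h (drop (Suc i) v))"
  proof (rule sum.cong[OF refl])
    fix i
    have "inj_on (\<lambda>(s, t). Node b s t) A" for A by (auto simp: inj_on_def)
    then have "(\<Sum>t\<in>(\<lambda>(s, t). Node b s t) ` (ptrees (take i v) \<times> ptrees (drop (Suc i) v)).
          tree_volume h t) =
       (\<Sum>(s, t)\<in>ptrees (take i v) \<times> ptrees (drop (Suc i) v).
          edge_int h b (tree_volume h s) * tree_volume h t)"
      by (subst sum.reindex) (auto intro!: sum.cong)
    then show "(\<Sum>t\<in>(\<lambda>(s, t). Node b s t) ` (ptrees (take i v) \<times> ptrees (drop (Suc i) v)).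
          tree_volume h t) =
        edge_int h b (word_volume h (take i v)) * word_volume h (drop (Suc i) v)"
      by (simp add: word_volume_def edge_int_sum sum_product sum.cartesian_product)
  qed
  finally show ?thesis .
qed

lemma word_volume_Cons_0: "s \<noteq> 1 \<Longrightarrow> s \<noteq> -1 \<Longrightarrow> word_volume h (s # v) = 0"
  by (simp add: word_volume_def ptrees_Cons_0)

lemma sum_list_contour: "sum_list (contour t) = 0"
  by (induction t) auto

lemma word_volume_nonzero_sum_list:
  assumes "word_volume h w \<noteq> 0"
  shows "sum_list w = 0"
proof -
  have "ptrees w \<noteq> {}" using assms by (auto simp: word_volume_def)
  then show ?thesis by (auto simp: ptrees_def sum_list_contour)
qed

section \<open>The generating series of the volumes and its differential equation\<close>

definition volume_series :: "real \<Rightarrow> real poly nc_series" where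
  "volume_series h = NC_Series (word_volume h)"

definition edge_series :: "real \<Rightarrow> bool \<Rightarrow> real poly nc_series" where
  "edge_series h b = NC_Series (\<lambda>w. edge_int h b (word_volume h w))"

lemma nc_coeff_volume_series [simp]: "nc_coeff (volume_series h) w = word_volume h w"
  by (simp add: volume_series_def)

lemma volume_series_edge:
  "nc_coeff (letter (sgn_of b) * edge_series h b * letter (- sgn_of b) * volume_series h) (c # v) =
     (if c = sgn_of b then word_volume h (c # v) else 0)"
proof -
  have "nc_coeff (edge_series h b * (letter (- sgn_of b) * volume_series h)) v =
     (\<Sum>i\<le>length v. edge_int h b (word_volume h (take i v)) *
        (if i < length v \<and> v ! i = - sgn_of b then word_volume h (drop (Suc i) v) else 0))"
    unfolding nc_coeff_mult[of "edge_series h b"]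
    by (intro sum.cong) (auto simp: nc_coeff_letter_mult edge_series_def hd_drop_conv_nth
        tl_drop[symmetric] drop_Suc)
  also have "\<dots> = (\<Sum>i | i < length v \<and> v ! i = - sgn_of b.
        edge_int h b (word_volume h (take i v)) * word_volume h (drop (Suc i) v))"
    by (intro sum.mono_neutral_cong_right) auto
  also have "\<dots> = word_volume h (sgn_of b # v)"
    by (simp add: word_volume_Cons)
  finally show ?thesis
    by (simp add: mult.assoc nc_coeff_letter_mult)
qed

text \<open>This is the cut at the return of the first edge, summed over all words; the two summands
  belong to a first child above and below the root.\<close>

lemma volume_series_rec:
  "volume_series h = 1 + (letter 1 * edge_series h True * letter (-1) +
     letter (-1) * edge_series h False * letter 1) * volume_series h"
proof (rule nc_series_eqI)
  fix w
  show "nc_coeff (volume_series h) w = nc_coeff (1 + (letter 1 * edge_series h True * letter (-1) +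
     letter (-1) * edge_series h False * letter 1) * volume_series h) w"
  proof (cases w)
    case Nil
    then show ?thesis
      by (simp add: distrib_right mult.assoc nc_coeff_letter_mult)
  next
    case (Cons c v)
    then show ?thesis
      using volume_series_edge[of True h c v] volume_series_edge[of False h c v]
      by (auto simp: distrib_right sgn_of_def word_volume_Cons_0)
  qed
qed

lemma nc_deriv_edge_series:
  "nc_deriv (edge_series h b) = (if b then volume_series h else - volume_series h)"
  by (rule nc_series_eqI) (simp add: edge_series_def pderiv_edge_int)

theorem nc_deriv_volume_series:
  "nc_deriv (volume_series h) = volume_series h *
     (letter 1 * volume_series h * letter (-1) - letter (-1) * volume_series h * letter 1) *
     volume_series h"
proof -
  define P where "P = volume_series h"
  define a b :: "real poly nc_series" where "a = letter 1" and "b = letter (-1)"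
  define K where "K = a * edge_series h True * b + b * edge_series h False * a"
  define Q where "Q = a * P * b - b * P * a"
  have P: "P = 1 + K * P"
    using volume_series_rec[of h] by (simp add: P_def K_def a_def b_def)
  have K': "nc_deriv K = Q"
    by (simp add: K_def Q_def a_def b_def nc_deriv_simps nc_deriv_edge_series P_def)
  \<comment> \<open>No inverse of 1 - K is formed. Both P' and P Q P solve z = Q P + K z, and their
    difference vanishes because K has no constant term.\<close>
  have "nc_deriv P = Q * P + K * nc_deriv P"
    using arg_cong[OF P, of nc_deriv] by (simp add: nc_deriv_simps K')
  moreover have "P * Q * P = Q * P + K * (P * Q * P)"
    by (subst (1) P) (simp add: distrib_right mult.assoc)
  ultimately have "nc_deriv P - P * Q * P = K * (nc_deriv P - P * Q * P)"
    by (simp add: right_diff_distrib) (metis add_diff_cancel_left)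
  moreover have "nc_coeff K [] = 0"
    by (simp add: K_def a_def b_def mult.assoc nc_coeff_letter_mult)
  ultimately have "nc_deriv P - P * Q * P = 0"
    using nc_series_fixed_point_0 by blast
  then show ?thesis by (simp add: P_def Q_def a_def b_def)
qed

text \<open>Words with \<open>n\<close> selected letters, weighted by the volumes of the \<open>n + 1\<close> gaps.\<close>

fun selection_series :: "real \<Rightarrow> nat \<Rightarrow> real poly nc_series" where
  "selection_series h 0 = volume_series h"
| "selection_series h (Suc n) =
     volume_series h * (letter 1 + letter (-1)) * selection_series h n"

lemma selection_series_comp:
  "selection_series h m * (letter 1 + letter (-1)) * selection_series h n =
     selection_series h (Suc (m + n))"
  by (induction m) (simp_all add: mult.assoc)

text \<open>
  As \<open>a P b - b P a = a P (a + b) - (a + b) P a\<close>, the sum over the gaps telescopes.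
\<close>

lemma nc_deriv_selection_series:
  "nc_deriv (selection_series h n) =
     volume_series h * letter 1 * selection_series h (Suc n) -
     selection_series h (Suc n) * letter 1 * volume_series h"
proof (induction n)
  case 0
  show ?case
    by (simp add: nc_deriv_volume_series algebra_simps)
next
  case (Suc n)
  define P where "P = volume_series h"
  define a w :: "real poly nc_series" where "a = letter 1" and "w = letter 1 + letter (-1)"
  define R where "R = selection_series h"
  have R0: "R 0 = P" by (simp add: R_def P_def)
  have RS: "R (Suc k) = P * w * R k" for k by (simp add: R_def P_def w_def)
  have P': "nc_deriv P = P * a * R 1 - R 1 * a * P"
    by (simp add: P_def a_def R_def nc_deriv_volume_series algebra_simps)
  have "nc_deriv (R (Suc n)) = nc_deriv P * w * R n + P * w * nc_deriv (R n)"
    unfolding RS by (simp add: nc_deriv_simps w_def)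
  also have "nc_deriv P * w * R n = P * a * (R 1 * w * R n) - R 1 * a * P * w * R n"
    unfolding P' by (simp add: left_diff_distrib mult.assoc)
  also have "R 1 * w * R n = R (Suc (Suc n))"
    using selection_series_comp[of h 1 n] by (simp add: R_def w_def)
  \<comment> \<open>This term, negative here, cancels the positive term of the induction hypothesis
    multiplied by P w.\<close>
  also have "R 1 * a * P * w * R n = P * w * P * a * R (Suc n)"
    by (simp add: RS R0 mult.assoc)
  also have "P * w * nc_deriv (R n) =
      P * w * P * a * R (Suc n) - R (Suc (Suc n)) * a * P"
    unfolding R_def Suc.IH unfolding R_def[symmetric] P_def[symmetric] a_def[symmetric]
    by (simp add: RS right_diff_distrib mult.assoc)
  finally show ?case
    by (simp only: R_def P_def a_def) simp
qed

section \<open>Selections of letters\<close>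


lemma nc_coeff_selection_append:
  "nc_coeff (selection_series h (Suc n)) w =
     nc_coeff (volume_series h * letter 1 * selection_series h n) w +
     nc_coeff (volume_series h * letter (-1) * selection_series h n) w"
  by (simp add: algebra_simps)

lemma selection_series_Suc_right:
  "selection_series h (Suc n) =
     selection_series h n * (letter 1 + letter (-1)) * volume_series h"
  using selection_series_comp[of h n 0] by simp

definition dyck :: "int list \<Rightarrow> bool" where
  "dyck w \<longleftrightarrow> sum_list w = 0 \<and> (\<forall>u v. w = u @ v \<longrightarrow> sum_list u \<ge> 0)"

text \<open>Only balanced words have a nonzero volume, so a nonzero coefficient places the letter
  \<open>s\<close> directly after a balanced prefix.\<close>

lemma volume_letter_nz:
  assumes "nc_coeff (volume_series h * letter s * x) w \<noteq> 0"
  obtains u v where "w = u @ s # v" "sum_list u = 0"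
proof -
  from assms have "nc_coeff (volume_series h * (letter s * x)) w \<noteq> 0"
    by (simp add: mult.assoc)
  then obtain u v where uv: "w = u @ v" "word_volume h u \<noteq> 0" "nc_coeff (letter s * x) v \<noteq> 0"
    by (auto elim: nc_coeff_mult_nz)
  from uv(3) have "v = s # tl v"
    by (cases v) (auto simp: nc_coeff_letter_mult split: if_splits)
  with uv(1) have "w = u @ s # tl v" by simp
  then show thesis using uv(2) word_volume_nonzero_sum_list that by blast
qed

lemma letter_volume_nz:
  assumes "nc_coeff (x * letter s * volume_series h) w \<noteq> 0"
  obtains u v where "w = u @ s # v" "sum_list v = 0"
proof -
  from assms obtain u v where uv: "w = u @ v" "nc_coeff (x * letter s) u \<noteq> 0"
      "word_volume h v \<noteq> 0"
    by (auto elim: nc_coeff_mult_nz)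
  from uv(2) have "u = butlast u @ [s]"
    by (cases u rule: rev_cases) (auto simp: nc_coeff_mult_letter split: if_splits)
  with uv(1) have "w = butlast u @ s # v" by (metis append.assoc append_Cons append_Nil)
  then show thesis using uv(3) word_volume_nonzero_sum_list that by blast
qed

text \<open>In P a R_(n+1) the letter a may be replaced by a + b, since no balanced prefix of a Dyck
  word is followed by -1. The term R_(n+1) a P vanishes: a balanced suffix preceded by 1 would leave
  a prefix of sum -1.\<close>

lemma pderiv_selection_dyck:
  assumes "dyck w"
  shows "pderiv (nc_coeff (selection_series h n) w) =
     nc_coeff (selection_series h (Suc (Suc n))) w"
proof -
  have "nc_coeff (volume_series h * letter (-1) * selection_series h (Suc n)) w = 0"
  proof (rule ccontr)
    assume "\<not> ?thesis"
    then obtain u v where "w = (u @ [-1]) @ v" "sum_list u = 0"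
      by (elim volume_letter_nz) simp
    with assms have "sum_list (u @ [-1]) \<ge> 0" unfolding dyck_def by blast
    with \<open>sum_list u = 0\<close> show False by simp
  qed
  moreover have "nc_coeff (selection_series h (Suc n) * letter 1 * volume_series h) w = 0"
  proof (rule ccontr)
    assume "\<not> ?thesis"
    then obtain u v where uv: "w = u @ 1 # v" "sum_list v = 0"
      by (elim letter_volume_nz) simp
    with assms have "sum_list u \<ge> 0" "sum_list w = 0" unfolding dyck_def by blast+
    with uv show False by simp
  qed
  ultimately show ?thesis
    using arg_cong[OF nc_deriv_selection_series[of h n], of "\<lambda>x. nc_coeff x w"]
    unfolding nc_coeff_selection_append[of h "Suc n"] by simp
qed

text \<open>With the signs reversed, the first term of the derivative vanishes and the second
  becomes the full R_(n+2); this is where the minus sign comes from.\<close>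

lemma pderiv_selection_neg_dyck:
  assumes "dyck (map uminus w)"
  shows "pderiv (nc_coeff (selection_series h n) w) =
     - nc_coeff (selection_series h (Suc (Suc n))) w"
proof -
  have sum_neg: "sum_list (map uminus v) = - sum_list v" for v :: "int list"
    by (induction v) auto
  have neg: "sum_list u \<le> 0" if "w = u @ v" for u v
    using assms sum_neg[of u] that unfolding dyck_def
    by (metis map_append neg_0_le_iff_le)
  have bal: "sum_list w = 0" using assms by (simp add: dyck_def sum_neg)
  have "nc_coeff (volume_series h * letter 1 * selection_series h (Suc n)) w = 0"
  proof (rule ccontr)
    assume "\<not> ?thesis"
    then obtain u v where "w = (u @ [1]) @ v" "sum_list u = 0"
      by (elim volume_letter_nz) simp
    with neg[of "u @ [1]" v] show False by simp
  qed
  moreover have "nc_coeff (selection_series h (Suc n) * letter (-1) * volume_series h) w = 0"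
  proof (rule ccontr)
    assume "\<not> ?thesis"
    then obtain u v where uv: "w = u @ -1 # v" "sum_list v = 0"
      by (elim letter_volume_nz) simp
    with bal neg[of u "-1 # v"] show False by simp
  qed
  moreover have "nc_coeff (selection_series h (Suc (Suc n))) w =
      nc_coeff (selection_series h (Suc n) * letter 1 * volume_series h) w +
      nc_coeff (selection_series h (Suc n) * letter (-1) * volume_series h) w"
    by (subst selection_series_Suc_right) (simp add: algebra_simps)
  ultimately show ?thesis
    using arg_cong[OF nc_deriv_selection_series[of h n], of "\<lambda>x. nc_coeff x w"]
    by (simp del: selection_series.simps)
qed

lemma higher_pderiv_word_volume_dyck:
  assumes "dyck w"
  shows "(pderiv ^^ n) (word_volume h w) = nc_coeff (selection_series h (2 * n)) w"
  by (induction n) (simp_all add: pderiv_selection_dyck[OF assms] del: selection_series.simps(2))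

lemma higher_pderiv_word_volume_neg_dyck:
  assumes "dyck (map uminus w)"
  shows "(pderiv ^^ n) (word_volume h w) =
    (-1) ^ n * nc_coeff (selection_series h (2 * n)) w"
proof (induction n)
  case (Suc n)
  have "pderiv ((-1) ^ n * p) = (-1) ^ n * pderiv p" for p :: "real poly"
    by (induction n) (simp_all add: pderiv_minus)
  with Suc show ?case
    by (simp add: pderiv_selection_neg_dyck[OF assms] del: selection_series.simps(2))
qed simp

text \<open>At \<open>y = 0\<close> the root is the greatest vertex.\<close>

lemma poly_word_volume_up_first: "poly (word_volume h (1 # v)) 0 = 0"
  using word_volume_Cons[of h True v] by (simp add: sgn_of_def poly_sum edge_int_def)

text \<open>A final -1 is the return along the last edge at the root. That edge leads to a vertex
  above the root, for which no room is left at y = 0.\<close>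

lemma poly_tree_volume_up_last:
  "contour t = v @ [-1] \<Longrightarrow> poly (tree_volume h t) 0 = 0"
proof (induction t arbitrary: v)
  case (Node b s t)
  show ?case
  proof (cases "contour t" rule: rev_cases)
    case Nil
    with Node.prems have "b" by (auto simp: sgn_of_def split: if_splits)
    then show ?thesis by (simp add: edge_int_def)
  next
    case (snoc u c)
    with Node.prems have "c = -1" by (metis append_Cons append_assoc contour.simps(2) last_snoc)
    with snoc Node.IH(2) show ?thesis by simp
  qed
qed simp

lemma poly_word_volume_up_last: "poly (word_volume h (v @ [-1])) 0 = 0"
  unfolding word_volume_def poly_sum
  by (rule sum.neutral) (auto simp: ptrees_def poly_tree_volume_up_last)

definition selection :: "real \<Rightarrow> nat \<Rightarrow> int list \<Rightarrow> real" where
  "selection h n w = poly (nc_coeff (selection_series h n) w) 0"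

lemma selection_0_Cons: "selection h 0 (1 # v) = 0"
  by (simp add: selection_def poly_word_volume_up_first)

lemma selection_0_snoc: "selection h 0 (v @ [-1]) = 0"
  by (simp add: selection_def poly_word_volume_up_last)

text \<open>A nonempty gap before the first selected letter would start with 1 and have volume 0 at
  y = 0. Hence the leading 1 is itself selected.\<close>

lemma selection_Suc_Cons: "selection h (Suc n) (1 # v) = selection h n v"
proof -
  let ?x = "(letter 1 + letter (-1)) * selection_series h n :: real poly nc_series"
  have "selection h (Suc n) (1 # v) =
     (\<Sum>i\<le>Suc (length v). poly (word_volume h (take i (1 # v)) * nc_coeff ?x (drop i (1 # v))) 0)"
    unfolding selection_def selection_series.simps mult.assoc nc_coeff_mult[of "volume_series h"]
    by (simp add: poly_sum)
  also have "\<dots> = (\<Sum>i\<le>Suc (length v). if i = 0 then poly (nc_coeff ?x (1 # v)) 0 else 0)"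
    by (intro sum.cong) (auto simp: take_Cons' poly_word_volume_up_first)
  also have "\<dots> = selection h n v"
    by (simp add: selection_def distrib_right nc_coeff_letter_mult)
  finally show ?thesis .
qed

lemma selection_Suc_snoc: "selection h (Suc n) (v @ [-1]) = selection h n v"
proof -
  let ?x = "selection_series h n * (letter 1 + letter (-1)) :: real poly nc_series"
  let ?w = "v @ [-1 :: int]"
  have "selection h (Suc n) ?w =
     (\<Sum>i\<le>length ?w. poly (nc_coeff ?x (take i ?w) * word_volume h (drop i ?w)) 0)"
    unfolding selection_def selection_series_Suc_right nc_coeff_mult[of ?x] poly_sum
    by simp
  also have "\<dots> = (\<Sum>i\<le>length ?w. if i = length ?w then poly (nc_coeff ?x ?w) 0 else 0)"
    by (intro sum.cong) (auto simp: poly_word_volume_up_last)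
  also have "\<dots> = selection h n v"
    by (simp add: selection_def distrib_left nc_coeff_mult_letter)
  finally show ?thesis .
qed

text \<open>At y = 0 each of the \<open>2 * k\<close> outer letters is forced to be selected, which
  leaves \<open>n - 2 * k\<close> selections for \<open>w\<close>.\<close>

lemma selection_surround:
  "selection h n (replicate k 1 @ w @ replicate k (-1)) =
     (if 2 * k \<le> n then selection h (n - 2 * k) w else 0)"
proof (induction k arbitrary: n)
  case (Suc k)
  let ?v = "replicate k 1 @ w @ replicate k (-1)"
  have v: "replicate (Suc k) 1 @ w @ replicate (Suc k) (-1) = 1 # ?v @ [-1]"
    by (simp add: replicate_append_same[symmetric])
  \<comment> \<open>A single selection is spent on the leading 1; what remains ends with -1 and
    vanishes without a further selection.\<close>
  consider "n = 0" | "n = 1" | n' where "n = Suc (Suc n')"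
    by (metis One_nat_def old.nat.exhaust)
  then show ?case
  proof cases
    case 3
    then show ?thesis unfolding v selection_Suc_Cons 3
      by (simp only: selection_Suc_Cons selection_Suc_snoc Suc.IH) auto
  qed (use selection_0_snoc[of h ?v] in \<open>auto simp: v selection_0_Cons selection_Suc_Cons
        simp del: replicate_Suc\<close>)
qed simp

text \<open>On the outer word n derivatives are 2n selections, of which 2k are forced. The other 2(n
  - k) selections are n - k derivatives of \<open>w\<close>, up to the sign due to its nonpositive
  partial sums.\<close>

theorem higher_pderiv_word_volume_surround:
  assumes "dyck (replicate k 1 @ w @ replicate k (-1))" "dyck (map uminus w)"
  shows "poly ((pderiv ^^ n) (word_volume h (replicate k 1 @ w @ replicate k (-1)))) 0 =
     (if k \<le> n then (-1) ^ (n - k) * poly ((pderiv ^^ (n - k)) (word_volume h w)) 0 else 0)"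
proof -
  have "(-1) ^ j * poly ((-1) ^ j * p) 0 = poly p 0" for j and p :: "real poly"
    by (induction j) auto
  moreover have "2 * n - 2 * k = 2 * (n - k)" by simp
  ultimately show ?thesis
    using selection_surround[of h "2 * n" k w]
    by (simp add: higher_pderiv_word_volume_dyck[OF assms(1)]
        higher_pderiv_word_volume_neg_dyck[OF assms(2)] selection_def)
qed

section \<open>The words \<open>\<epsilon>\<^sub>m\<close>\<close>


fun flip :: "ptree \<Rightarrow> ptree" where
  "flip Leaf = Leaf"
| "flip (Node b s t) = Node (\<not> b) (flip s) (flip t)"

lemma flip_flip [simp]: "flip (flip t) = t"
  by (induction t) auto

lemma contour_flip: "contour (flip t) = map uminus (contour t)"
  by (induction t) (auto simp: sgn_of_def)

lemma ptrees_map_uminus: "ptrees (map uminus w) = flip ` ptrees w"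
proof -
  have "t \<in> flip ` ptrees w" if "t \<in> ptrees (map uminus w)" for t
    using that by (intro image_eqI[of _ _ "flip t"]) (auto simp: ptrees_def contour_flip comp_def)
  then show ?thesis by (auto simp: ptrees_def contour_flip)
qed

text \<open>Turning the interval upside down exchanges the parts above and below the root and
  replaces y by h - y.\<close>

lemma edge_int_flip:
  "edge_int h (\<not> b) (p \<circ>\<^sub>p [:h, -1:]) = edge_int h b p \<circ>\<^sub>p [:h, -1:]"
proof (rule edge_int_unique)
  show "pderiv (edge_int h b p \<circ>\<^sub>p [:h, -1:]) =
      (if \<not> b then p \<circ>\<^sub>p [:h, -1:] else - (p \<circ>\<^sub>p [:h, -1:]))"
    by (simp add: pderiv_pcompose pderiv_edge_int pcompose_uminus pderiv_pCons)
  show "poly (edge_int h b p \<circ>\<^sub>p [:h, -1:]) (if \<not> b then 0 else h) = 0"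
    by (simp add: poly_pcompose edge_int_def)
qed

lemma tree_volume_flip: "tree_volume h (flip t) = tree_volume h t \<circ>\<^sub>p [:h, -1:]"
  by (induction t) (simp_all add: edge_int_flip pcompose_mult pcompose_1)

lemma word_volume_map_uminus: "word_volume h (map uminus w) = word_volume h w \<circ>\<^sub>p [:h, -1:]"
  unfolding word_volume_def ptrees_map_uminus pcompose_sum
  by (subst sum.reindex) (auto intro: inj_on_inverseI[of _ flip] simp: tree_volume_flip)

lemma higher_pderiv_reflect:
  "(pderiv ^^ n) (p \<circ>\<^sub>p [:h, -1:]) = smult ((-1) ^ n) ((pderiv ^^ n) p \<circ>\<^sub>p [:h, -1 :: real:])"
  by (induction n) (simp_all add: pderiv_pcompose pderiv_smult pderiv_pCons)

section \<open>Taylor coefficients, divided powers and the polynomial of the tuples\<close>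

lemma poly_higher_pderiv_0: "poly ((pderiv ^^ n) p) 0 = fact n * coeff (p :: real poly) n"
  by (induction n arbitrary: p)
    (simp_all add: poly_0_coeff_0 funpow_swap1 coeff_pderiv algebra_simps)

lemma poly_eq_higher_pderivI:
  "(\<And>n. poly ((pderiv ^^ n) p) 0 = poly ((pderiv ^^ n) q) (0 :: real)) \<Longrightarrow> p = q"
  by (rule poly_eqI) (simp add: poly_higher_pderiv_0)

text \<open>Divided powers p^n / n!: their multiplication rule carries exactly the binomial
  coefficients that count interleavings.\<close>

definition divpow :: "real poly \<Rightarrow> nat \<Rightarrow> real poly" where
  "divpow p n = smult (1 / fact n) (p ^ n)"

lemma divpow_0 [simp]: "divpow p 0 = 1"
  by (simp add: divpow_def)

lemma pderiv_divpow: "pderiv (divpow p (Suc n)) = divpow p n * pderiv p"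
proof -
  have "1 / fact (Suc n) * real (Suc n) = 1 / fact n"
    by (simp add: field_simps del: of_nat_Suc)
  then show ?thesis
    unfolding divpow_def pderiv_smult pderiv_power_Suc by (simp del: of_nat_Suc fact_Suc power_Suc)
qed

lemma divpow_mult: "divpow p m * divpow p n = of_nat (m + n choose m) * divpow p (m + n)"
  by (simp add: divpow_def power_add binomial_fact of_nat_poly mult.commute)

lemma divpow_add: "divpow (p + q) n = (\<Sum>k\<le>n. divpow p k * divpow q (n - k))"
proof -
  have "divpow (p + q) n = [:1 / fact n:] * (\<Sum>k\<le>n. of_nat (n choose k) * p ^ k * q ^ (n - k))"
    by (simp add: divpow_def binomial_ring)
  also have "\<dots> = (\<Sum>k\<le>n. [:1 / fact n:] * (of_nat (n choose k) * p ^ k * q ^ (n - k)))"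
    by (rule sum_distrib_left)
  also have "\<dots> = (\<Sum>k\<le>n. divpow p k * divpow q (n - k))"
  proof (rule sum.cong[OF refl])
    fix k assume "k \<in> {..n}"
    then have "real (n choose k) / fact n = 1 / fact k * (1 / fact (n - k))"
      by (simp add: binomial_fact)
    then show "[:1 / fact n:] * (of_nat (n choose k) * p ^ k * q ^ (n - k)) =
        divpow p k * divpow q (n - k)"
      by (simp add: divpow_def of_nat_poly mult.commute)
  qed
  finally show ?thesis .
qed

lemma divpow_const: "divpow [:c:] n = [:c ^ n / fact n:]"
  by (simp add: divpow_def poly_const_pow)

abbreviation pvar :: "real poly" where
  "pvar \<equiv> [:0, 1:]"

lemma higher_pderiv_divpow_pvar:
  "(pderiv ^^ n) (divpow pvar k) = (if n \<le> k then divpow pvar (k - n) else 0)"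
proof (induction n)
  case (Suc n)
  show ?case
  proof (cases "n < k")
    case True
    then have "k - n = Suc (k - Suc n)" by simp
    with True Suc show ?thesis by (simp add: pderiv_divpow pderiv_pCons)
  next
    case False
    with Suc show ?thesis by (cases "n = k") auto
  qed
qed simp

text \<open>The weight of S: in exponential generating functions a factor \<open>word_iota\<close>
  with s letters becomes (X + Y)^s / s! = h^s / s!, while the last factor, with all letters after r,
  becomes a divided power of Y = y.\<close>

definition tuple_poly :: "real \<Rightarrow> nat \<Rightarrow> (nat \<Rightarrow> nat) \<Rightarrow> real poly" where
  "tuple_poly h m l =
     (\<Sum>s\<in>tuples m l. smult (\<Prod>i=1..<m. h ^ s i / fact (s i)) (divpow pvar (s m)))"

lemma poly_higher_pderiv_tuple_poly:
  "poly ((pderiv ^^ n) (tuple_poly h m l)) y =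
     (\<Sum>s | s \<in> tuples m l \<and> n \<le> s m.
        (\<Prod>i=1..<m. h ^ s i / fact (s i)) * (y ^ (s m - n) / fact (s m - n)))"
proof -
  have "poly ((pderiv ^^ n) (tuple_poly h m l)) y = (\<Sum>s\<in>tuples m l. if n \<le> s m then
        (\<Prod>i=1..<m. h ^ s i / fact (s i)) * (y ^ (s m - n) / fact (s m - n)) else 0)"
    unfolding tuple_poly_def higher_pderiv_sum higher_pderiv_smult poly_sum
      higher_pderiv_divpow_pvar
    by (intro sum.cong) (auto simp: divpow_def)
  also have "\<dots> = (\<Sum>s | s \<in> tuples m l \<and> n \<le> s m.
        (\<Prod>i=1..<m. h ^ s i / fact (s i)) * (y ^ (s m - n) / fact (s m - n)))"
    using finite_tuples by (intro sum.mono_neutral_cong_right) auto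
  finally show ?thesis .
qed

text \<open>At y = 0 the n-th derivative keeps the tuples with s_(m+1) = n; the bound on the first m
  entries forces n to be at least l_(m+1). The remaining factor h^(s_m) / s_m! is the d-th
  derivative at h of the divided power of degree s_m + d, for d = n - l_(m+1).\<close>

lemma poly_higher_pderiv_tuple_poly_Suc:
  assumes "m \<ge> 1"
  shows "poly ((pderiv ^^ n) (tuple_poly h (Suc m) l)) 0 =
     (if l (Suc m) \<le> n then poly ((pderiv ^^ (n - l (Suc m))) (tuple_poly h m l)) h else 0)"
proof -
  let ?k = "l (Suc m)"
  let ?c = "\<lambda>m s. (\<Prod>i=1..<m. h ^ s i / fact (s i)) :: real"
  let ?A = "{s \<in> tuples (Suc m) l. s (Suc m) = n}"
  have "poly ((pderiv ^^ n) (tuple_poly h (Suc m) l)) 0 = sum (?c (Suc m)) ?A"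
    unfolding poly_higher_pderiv_tuple_poly
    by (intro sum.mono_neutral_cong_right) (auto simp: finite_tuples)
  also have "\<dots> = (if ?k \<le> n then poly ((pderiv ^^ (n - ?k)) (tuple_poly h m l)) h else 0)"
  proof (cases "?k \<le> n")
    case False
    have "s (Suc m) \<ge> ?k" if "s \<in> tuples (Suc m) l" for s
    proof -
      have "(\<Sum>i=1..m. s i) + s (Suc m) = (\<Sum>i=1..m. l i) + ?k"
        "(\<Sum>i=1..m. s i) \<le> (\<Sum>i=1..m. l i)"
        using that assms by (auto simp: tuples_def)
      then show ?thesis by linarith
    qed
    with False have "?A = {}" by auto
    with False show ?thesis by (simp only: sum.empty if_False)
  next
    case True
    define d where "d = n - ?k"
    \<comment> \<open>In a tuple with last entry n the first m entries fall short of l_1 + ... + l_m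
      by exactly d; \<open>f\<close> gives this deficit to entry m, and \<open>g\<close> takes it
      back.\<close>
    define f where "f s = restrict (s(m := s m + d)) {1..m}" for s :: "nat \<Rightarrow> nat"
    define g where "g s = restrict (s(m := s m - d, Suc m := n)) {1..Suc m}" for s :: "nat \<Rightarrow> nat"
    have sum_upd: "(\<Sum>j=1..i. f s j) = (\<Sum>j=1..i. s j) + (if i = m then d else 0)"
      if "i \<le> m" for i s
    proof -
      have "(\<Sum>j=1..i. f s j) = (\<Sum>j=1..i. s j + (if j = m then d else 0))"
        using that by (intro sum.cong) (auto simp: f_def)
      also have "\<dots> = (\<Sum>j=1..i. s j) + (if i = m then d else 0)"
        using that assms by (simp add: sum.distrib)
      finally show ?thesis .
    qed
    have gf: "g (f s) = s" if "s \<in> ?A" for s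
      using that assms by (auto simp: f_def g_def fun_eq_iff tuples_def extensional_def)
    have fg: "f (g s) = s" if "s \<in> tuples m l" "d \<le> s m" for s
      using that assms by (auto simp: f_def g_def fun_eq_iff tuples_def extensional_def)
    have f: "f s \<in> tuples m l" "d \<le> f s m" if "s \<in> ?A" for s
    proof -
      have s: "(\<Sum>i=1..m. s i) + n = (\<Sum>i=1..m. l i) + ?k"
        "\<forall>i\<in>{1..m}. (\<Sum>j=1..i. s j) \<le> (\<Sum>j=1..i. l j)"
        using that by (auto simp: tuples_def)
      then have "(\<Sum>j=1..m. f s j) = (\<Sum>j=1..m. l j)"
        using True sum_upd[of m s] by (simp add: d_def)
      moreover have "\<forall>i\<in>{1..m-1}. (\<Sum>j=1..i. f s j) \<le> (\<Sum>j=1..i. l j)"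
        using s(2) sum_upd[of _ s] by auto
      ultimately show "f s \<in> tuples m l" by (simp add: tuples_def f_def)
      show "d \<le> f s m" using assms by (simp add: f_def)
    qed
    have g: "g s \<in> ?A" if "s \<in> tuples m l" "d \<le> s m" for s
    proof -
      have *: "(\<Sum>j=1..i. s j) = (\<Sum>j=1..i. g s j) + (if i = m then d else 0)" if "i \<le> m" for i
        using sum_upd[OF that, of "g s"] fg \<open>s \<in> tuples m l\<close> \<open>d \<le> s m\<close> by simp
      have gS: "g s (Suc m) = n" by (simp add: g_def)
      have s: "(\<Sum>i=1..m. s i) = (\<Sum>i=1..m. l i)"
        "\<forall>i\<in>{1..m-1}. (\<Sum>j=1..i. s j) \<le> (\<Sum>j=1..i. l j)"
        using \<open>s \<in> tuples m l\<close> by (auto simp: tuples_def)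
      have "(\<Sum>i=1..Suc m. g s i) = (\<Sum>i=1..Suc m. l i)"
        using *[of m] s(1) True gS by (simp add: d_def)
      moreover have "(\<Sum>j=1..i. g s j) \<le> (\<Sum>j=1..i. l j)" if "i \<in> {1..m}" for i
        using *[of i] s that by (cases "i = m") force+
      ultimately show ?thesis using gS by (simp add: tuples_def g_def)
    qed
    have cf: "?c (Suc m) s = ?c m (f s) * (h ^ (f s m - d) / fact (f s m - d))" if "s \<in> ?A" for s
    proof -
      have "?c m (f s) = ?c m s" by (intro prod.cong) (auto simp: f_def)
      moreover have "f s m - d = s m" using assms by (simp add: f_def)
      ultimately show ?thesis using assms by (simp add: prod.atLeastLessThan_Suc)
    qed
    have "sum (?c (Suc m)) ?A = (\<Sum>s | s \<in> tuples m l \<and> d \<le> s m.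
        ?c m s * (h ^ (s m - d) / fact (s m - d)))"
      by (rule sum.reindex_bij_witness[where i = g and j = f]) (use gf fg f g cf in auto)
    with True show ?thesis unfolding poly_higher_pderiv_tuple_poly d_def by simp
  qed
  finally show ?thesis .
qed

lemma tuple_poly_1: "tuple_poly h 1 l = divpow pvar (l 1)"
proof -
  have "tuples 1 l = {restrict l {1}}"
    by (auto simp: tuples_def extensional_def restrict_def fun_eq_iff)
  then show ?thesis by (simp add: tuple_poly_def)
qed

section \<open>Partial sums of the sign sequences and the recursion in m\<close>

lemma eps_seq_0: "eps_seq 0 l = []"
  by (simp add: eps_seq_def)

lemma eps_seq_Suc:
  "eps_seq (Suc m) l =
     replicate (l (Suc m)) 1 @ map uminus (eps_seq m l) @ replicate (l (Suc m)) (-1)"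
proof -
  have r: "map (\<lambda>i. replicate (l i) ((-1) ^ (Suc m - i) :: int)) (rev [1..<m + 1]) =
      map (\<lambda>i. map uminus (replicate (l i) ((-1) ^ (m - i)))) (rev [1..<m + 1])"
    by (intro map_cong) (auto simp: Suc_diff_le)
  have u: "map (\<lambda>i. replicate (l i) ((-1) ^ (Suc m - i + 1) :: int)) [1..<m + 1] =
      map (\<lambda>i. map uminus (replicate (l i) ((-1) ^ (m - i + 1)))) [1..<m + 1]"
    by (intro map_cong) (auto simp: Suc_diff_le)
  have s: "[1..<Suc m + 1] = [1..<m + 1] @ [Suc m]" by simp
  show ?thesis
    unfolding eps_seq_def s rev_append map_append r u
    by (simp add: map_concat comp_def)
qed

lemma sum_list_map_uminus: "sum_list (map uminus v) = - sum_list (v :: int list)"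
  by (induction v) auto

lemma sum_list_take_surround:
  fixes w :: "int list"
  assumes "sum_list w = 0" "\<And>j. sum_list (take j w) \<le> 0 \<and> - int k \<le> sum_list (take j w)"
  shows "0 \<le> sum_list (take i (replicate k 1 @ w @ replicate k (-1))) \<and>
     sum_list (take i (replicate k 1 @ w @ replicate k (-1))) \<le> int k"
proof -
  have eq: "sum_list (take i (replicate k 1 @ w @ replicate k (-1))) =
      int (min i k) + sum_list (take (i - k) w) - int (min (i - k - length w) k)"
    by (simp add: sum_list_replicate)
  show ?thesis
  proof (cases "i < k \<or> i - k < length w")
    case True
    then show ?thesis unfolding eq using assms(2)[of "i - k"] by (auto simp: min_def)
  next
    case False
    then show ?thesis unfolding eq using assms(1) by (auto simp: min_def)
  qed
qed

lemma sum_list_eps_seq: "sum_list (eps_seq m l) = 0"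
  by (induction m) (simp_all add: eps_seq_0 eps_seq_Suc sum_list_map_uminus sum_list_replicate)

text \<open>The upper bound l_m is carried along for the induction: after the change of sign the
  partial sums lie between -l_m and 0, and the l_(m+1) new letters, at least l_m many, lift them
  back to nonnegative values.\<close>

lemma sum_list_take_eps_seq:
  assumes "mono_on {1..m} l"
  shows "0 \<le> sum_list (take i (eps_seq m l)) \<and>
     sum_list (take i (eps_seq m l)) \<le> (if m = 0 then 0 else int (l m))"
  using assms
proof (induction m arbitrary: i)
  case (Suc m)
  have "mono_on {1..m} l" using Suc.prems by (auto simp: mono_on_def)
  note IH = Suc.IH[OF this]
  have le: "l m \<le> l (Suc m)" if "m \<noteq> 0"
    using Suc.prems that by (auto simp: mono_on_def)
  have "0 \<le> sum_list (take i (eps_seq (Suc m) l)) \<and>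
     sum_list (take i (eps_seq (Suc m) l)) \<le> int (l (Suc m))"
    unfolding eps_seq_Suc
  proof (rule sum_list_take_surround)
    show "sum_list (map uminus (eps_seq m l)) = 0"
      by (simp add: sum_list_map_uminus sum_list_eps_seq)
    show "sum_list (take j (map uminus (eps_seq m l))) \<le> 0 \<and>
      - int (l (Suc m)) \<le> sum_list (take j (map uminus (eps_seq m l)))" for j
      using IH[of j] le by (auto simp: take_map sum_list_map_uminus split: if_splits)
  qed
  then show ?case by simp
qed (simp add: eps_seq_0)

lemma dyck_eps_seq: "mono_on {1..m} l \<Longrightarrow> dyck (eps_seq m l)"
  unfolding dyck_def using sum_list_take_eps_seq sum_list_eps_seq by (metis append_eq_conv_conj)

theorem word_volume_eps_seq:
  assumes "m \<ge> 1" "mono_on {1..m} l"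
  shows "word_volume h (eps_seq m l) = tuple_poly h m l"
  using assms
proof (induction m rule: dec_induct)
  case base
  have dyck: "dyck (replicate (l 1) 1 @ [] @ replicate (l 1) (-1))" "dyck (map uminus [])"
    using dyck_eps_seq[OF base] eps_seq_Suc[of 0 l] by (auto simp: eps_seq_0 dyck_def)
  have "poly ((pderiv ^^ n) (1 :: real poly)) 0 = (if n = 0 then 1 else 0)" for n
    by (simp add: poly_higher_pderiv_0)
  then have "word_volume h (eps_seq 1 l) = divpow pvar (l 1)"
    using higher_pderiv_word_volume_surround[OF dyck, of _ h] eps_seq_Suc[of 0 l]
    by (intro poly_eq_higher_pderivI)
      (auto simp: eps_seq_0 higher_pderiv_divpow_pvar, auto simp: divpow_def)
  then show ?case by (simp only: tuple_poly_1)
next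
  case (step m)
  have mono: "mono_on {1..m} l" using step.prems by (auto simp: mono_on_def)
  let ?w = "map uminus (eps_seq m l)"
  have dyck: "dyck (replicate (l (Suc m)) 1 @ ?w @ replicate (l (Suc m)) (-1))"
    "dyck (map uminus ?w)"
    using dyck_eps_seq[OF step.prems] dyck_eps_seq[OF mono] by (simp_all add: eps_seq_Suc comp_def)
  \<comment> \<open>The sign produced by the surrounding letters cancels the one produced by the
    chain rule for h - y, and y = 0 is sent to h.\<close>
  have "(-1) ^ n * poly ((pderiv ^^ n) (word_volume h ?w)) 0 =
      poly ((pderiv ^^ n) (tuple_poly h m l)) h" for n
    by (simp add: word_volume_map_uminus higher_pderiv_reflect poly_pcompose step.IH[OF mono]
        power_mult_distrib[symmetric] mult.assoc[symmetric])
  then show ?case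
    unfolding eps_seq_Suc using step.hyps
    by (intro poly_eq_higher_pderivI)
      (simp add: higher_pderiv_word_volume_surround[OF dyck] poly_higher_pderiv_tuple_poly_Suc)
qed

section \<open>Linear extensions of glued posets\<close>


fun before :: "'a list \<Rightarrow> 'a \<Rightarrow> 'a \<Rightarrow> bool" where
  "before [] a b \<longleftrightarrow> False"
| "before (x # xs) a b \<longleftrightarrow> x = a \<and> b \<in> set xs \<or> before xs a b"

lemma before_in_set: "before xs a b \<Longrightarrow> a \<in> set xs \<and> b \<in> set xs"
  by (induction xs) auto

lemma before_append:
  "before (xs @ ys) a b \<longleftrightarrow> before xs a b \<or> before ys a b \<or> a \<in> set xs \<and> b \<in> set ys"
  by (induction xs) (auto dest: before_in_set)

lemma before_filter: "P a \<Longrightarrow> P b \<Longrightarrow> before (filter P xs) a b \<longleftrightarrow> before xs a b"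
  by (induction xs) (auto dest: before_in_set)

lemma before_split: "distinct (A @ r # B) \<Longrightarrow> before (A @ r # B) r c \<longleftrightarrow> c \<in> set B"
  by (auto simp: before_append dest: before_in_set)

lemma before_split': "distinct (A @ r # B) \<Longrightarrow> before (A @ r # B) c r \<longleftrightarrow> c \<in> set A"
  by (auto simp: before_append dest: before_in_set)

definition lin_exts :: "'a set \<Rightarrow> 'a rel \<Rightarrow> 'a list set" where
  "lin_exts V E = {xs. distinct xs \<and> set xs = V \<and> (\<forall>(a, b)\<in>E. before xs a b)}"

lemma finite_lin_exts: "finite V \<Longrightarrow> finite (lin_exts V E)"
  by (rule finite_subset[of _ "{xs. set xs \<subseteq> V \<and> length xs \<le> card V}"])
    (auto simp: lin_exts_def distinct_card[symmetric] finite_lists_length_le)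

text \<open>X^p / p! times Y^q / q! with X = h - y and Y = y: the volume of a chain with p elements
  below and q above the root.\<close>

definition split_weight :: "real \<Rightarrow> nat \<Rightarrow> nat \<Rightarrow> real poly" where
  "split_weight h p q = divpow [:h, -1:] p * divpow pvar q"

definition root_weight :: "real \<Rightarrow> 'a \<Rightarrow> 'a list \<Rightarrow> real poly" where
  "root_weight h r xs = split_weight h (length (takeWhile (\<lambda>v. v \<noteq> r) xs))
     (length (tl (dropWhile (\<lambda>v. v \<noteq> r) xs)))"

lemma root_weight_split: "r \<notin> set A \<Longrightarrow> root_weight h r (A @ r # B) = split_weight h (length A) (length B)"
  by (simp add: root_weight_def takeWhile_append dropWhile_append)

text \<open>As X' = -1 and Y' = 1, the product rule makes the sum telescope; only its last term
  survives.\<close>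

lemma pderiv_split_weight_partial_sum:
  "pderiv (\<Sum>i\<le>p. split_weight h i (p + q + 1 - i)) = split_weight h p q"
proof (induction p arbitrary: q)
  case 0
  show ?case by (simp add: split_weight_def pderiv_divpow pderiv_pCons)
next
  case (Suc p)
  have eq: "(\<Sum>i\<le>Suc p. split_weight h i (Suc p + q + 1 - i)) =
      (\<Sum>i\<le>p. split_weight h i (p + Suc q + 1 - i)) + split_weight h (Suc p) (Suc q)"
    by simp
  show ?case
    unfolding eq pderiv_add Suc.IH
    by (simp add: split_weight_def pderiv_mult pderiv_divpow pderiv_pCons mult.commute)
qed

lemma split_weight_total: "(\<Sum>i\<le>n. split_weight h i (n - i)) = [:h ^ n / fact n:]"
  using divpow_add[of "[:h, -1:]" pvar n] by (simp add: split_weight_def divpow_const)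

text \<open>A chain of p + q + 1 elements contains c with p elements below it. A new root is
  inserted with i of these elements below it; it is below c if and only if i is at most p. The
  weights of the insertions add up to the integral over the position of c.\<close>

lemma edge_int_split_weight:
  "edge_int h b (split_weight h p q) =
     (\<Sum>i | i \<le> p + q + 1 \<and> (if b then i \<le> p else p < i). split_weight h i (p + q + 1 - i))"
proof (cases b)
  case True
  have "edge_int h True (split_weight h p q) = (\<Sum>i\<le>p. split_weight h i (p + q + 1 - i))"
  proof (rule edge_int_unique)
    show "poly (\<Sum>i\<le>p. split_weight h i (p + q + 1 - i)) (if True then 0 else h) = 0"
      unfolding poly_sum by (intro sum.neutral) (auto simp: split_weight_def divpow_def)
  qed (simp only: pderiv_split_weight_partial_sum if_True)
  with True show ?thesis by (simp add: atMost_def) (metis (no_types, lifting) le_SucI trans_le_add1)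
next
  case False
  let ?G = "\<Sum>i\<le>p. split_weight h i (p + q + 1 - i)"
  let ?S = "\<Sum>i\<in>{p<..p + q + 1}. split_weight h i (p + q + 1 - i)"
  have "?G + ?S = [:h ^ (p + q + 1) / fact (p + q + 1):]"
  proof -
    have eq: "{..p + q + 1} = {..p} \<union> {p<..p + q + 1}" by auto
    show ?thesis
      unfolding split_weight_total[symmetric] eq by (subst sum.union_disjoint) auto
  qed
  then have S: "?S = [:h ^ (p + q + 1) / fact (p + q + 1):] - ?G"
    by (metis add_diff_cancel_left')
  have "edge_int h False (split_weight h p q) = ?S"
  proof (rule edge_int_unique)
    show "pderiv ?S = (if False then split_weight h p q else - split_weight h p q)"
      unfolding S pderiv_diff pderiv_split_weight_partial_sum by (simp add: pderiv_pCons)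
    show "poly ?S (if False then 0 else h) = 0"
      unfolding poly_sum by (intro sum.neutral) (auto simp: split_weight_def divpow_def)
  qed
  moreover have "{p<..p + q + 1} = {i. i \<le> p + q + 1 \<and> p < i}" by auto
  ultimately show ?thesis using False by simp
qed

lemma append_in_shuffles:
  "A \<in> shuffles xs ys \<Longrightarrow> B \<in> shuffles xs' ys' \<Longrightarrow> A @ B \<in> shuffles (xs @ xs') (ys @ ys')"
proof (induction A arbitrary: xs ys)
  case (Cons a A)
  from Cons.prems(1) consider
      xs'' where "xs = a # xs''" "A \<in> shuffles xs'' ys"
    | ys'' where "ys = a # ys''" "A \<in> shuffles xs ys''"
    by (auto simp: Cons_in_shuffles_iff neq_Nil_conv)
  then show ?case
  proof cases
    case 1
    with Cons.IH[OF _ Cons.prems(2)] show ?thesis by (simp add: Cons_in_shuffles_leftI)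
  next
    case 2
    with Cons.IH[OF _ Cons.prems(2)] show ?thesis by (simp add: Cons_in_shuffles_rightI)
  qed
qed simp

lemma shuffles_split:
  assumes "set ys \<inter> set (Z1 @ r # Z2) = {}" "r \<notin> set Z1" "r \<notin> set Z2"
  shows "shuffles ys (Z1 @ r # Z2) =
    (\<Union>i\<le>length ys. (\<lambda>(A, B). A @ r # B) ` (shuffles (take i ys) Z1 \<times> shuffles (drop i ys) Z2))"
    (is "_ = ?U")
proof (rule set_eqI)
  fix xs
  show "xs \<in> shuffles ys (Z1 @ r # Z2) \<longleftrightarrow> xs \<in> ?U"
  proof
    assume xs: "xs \<in> shuffles ys (Z1 @ r # Z2)"
    then have "r \<in> set xs" by (auto dest: set_shuffles)
    then obtain A B where AB: "xs = A @ r # B" by (meson split_list)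
    define f where "f = filter (\<lambda>x. x \<in> set ys)"
    define g where "g = filter (\<lambda>x. x \<notin> set ys)"
    have "f xs = ys" "g xs = Z1 @ r # Z2"
      unfolding f_def g_def using filter_shuffles_disjoint1[OF assms(1) xs] by simp_all
    moreover have "r \<notin> set ys" using assms(1) by auto
    ultimately have fg: "ys = f A @ f B" "g A @ r # g B = Z1 @ r # Z2"
      by (simp_all add: AB f_def g_def)
    have "r \<notin> set Z1 \<and> r \<notin> set Z2" using assms(2,3) by simp
    with fg(2) have "g A = Z1" "g B = Z2"
      using append_Cons_eq_iff[of r Z1 Z2 "g A" "g B"] by auto
    then have "A \<in> shuffles (f A) Z1" "B \<in> shuffles (f B) Z2"
      using partition_in_shuffles[of A "\<lambda>x. x \<in> set ys"]
        partition_in_shuffles[of B "\<lambda>x. x \<in> set ys"] by (simp_all add: f_def g_def)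
    moreover have "length (f A) \<le> length ys" "take (length (f A)) ys = f A"
      "drop (length (f A)) ys = f B"
      by (simp_all add: fg(1))
    ultimately show "xs \<in> ?U" unfolding AB by (intro UN_I[of "length (f A)"]) auto
  next
    assume "xs \<in> ?U"
    then obtain i A B where "xs = A @ r # B" "A \<in> shuffles (take i ys) Z1"
        "B \<in> shuffles (drop i ys) Z2" by auto
    moreover from this(3) have "r # B \<in> shuffles (drop i ys) (r # Z2)"
      by (rule Cons_in_shuffles_rightI)
    ultimately show "xs \<in> shuffles ys (Z1 @ r # Z2)"
      using append_in_shuffles[of A "take i ys" Z1 "r # B" "drop i ys" "r # Z2"] by simp
  qed
qed

text \<open>The entry \<open>r\<close> occurs once and belongs to the second list, so a shuffle
  falls into its parts before and after \<open>r\<close>; \<open>i\<close> counts the entries of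
  \<open>ys\<close> before \<open>r\<close>.\<close>

lemma sum_shuffles_split:
  assumes "set ys \<inter> set (Z1 @ r # Z2) = {}" "r \<notin> set Z1" "r \<notin> set Z2"
  shows "(\<Sum>xs\<in>shuffles ys (Z1 @ r # Z2). f xs) =
    (\<Sum>i\<le>length ys. \<Sum>A\<in>shuffles (take i ys) Z1. \<Sum>B\<in>shuffles (drop i ys) Z2. f (A @ r # B))"
proof -
  let ?S = "\<lambda>i. shuffles (take i ys) Z1 \<times> shuffles (drop i ys) Z2"
  have no_r: "r \<notin> set A" "r \<notin> set B" if "(A, B) \<in> ?S i" for A B i
  proof -
    have "set A = set (take i ys) \<union> set Z1" "set B = set (drop i ys) \<union> set Z2"
      using that by (simp_all add: set_shuffles)
    then show "r \<notin> set A" "r \<notin> set B"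
      using assms set_take_subset[of i ys] set_drop_subset[of i ys] by auto
  qed
  have disj: "i = j" if "(A, B) \<in> ?S i" "(A', B') \<in> ?S j" "i \<le> length ys" "j \<le> length ys"
      "A @ r # B = A' @ r # B'" for A B A' B' i j
  proof -
    have "A = A'"
      using that(5) no_r[OF that(1)] append_Cons_eq_iff[of r A B A' B'] by simp
    moreover have "length A = i + length Z1" "length A' = j + length Z1"
      using that(1-4) length_shuffles[of A "take i ys" Z1] length_shuffles[of A' "take j ys" Z1]
      by simp_all
    ultimately show ?thesis by simp
  qed
  have "(\<Sum>xs\<in>shuffles ys (Z1 @ r # Z2). f xs) =
      (\<Sum>i\<le>length ys. \<Sum>xs\<in>(\<lambda>(A, B). A @ r # B) ` ?S i. f xs)"
    unfolding shuffles_split[OF assms]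
  proof (rule sum.UNION_disjoint)
    show "\<forall>i\<in>{..length ys}. \<forall>j\<in>{..length ys}. i \<noteq> j \<longrightarrow>
        (\<lambda>(A, B). A @ r # B) ` ?S i \<inter> (\<lambda>(A, B). A @ r # B) ` ?S j = {}"
    proof (intro ballI impI)
      fix i j assume ij: "i \<in> {..length ys}" "j \<in> {..length ys}" "i \<noteq> j"
      {
        fix xs assume xs: "xs \<in> (\<lambda>(A, B). A @ r # B) ` ?S i"
          "xs \<in> (\<lambda>(A, B). A @ r # B) ` ?S j"
        from xs(1) obtain A B where A: "(A, B) \<in> ?S i" "xs = A @ r # B" by auto
        from xs(2) obtain A' B' where A': "(A', B') \<in> ?S j" "xs = A' @ r # B'" by auto
        from disj[OF A(1) A'(1)] ij A(2) A'(2) have False by simp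
      }
      then show "(\<lambda>(A, B). A @ r # B) ` ?S i \<inter> (\<lambda>(A, B). A @ r # B) ` ?S j = {}" by blast
    qed
  qed auto
  also have "\<dots> = (\<Sum>i\<le>length ys. \<Sum>(A, B)\<in>?S i. f (A @ r # B))"
  proof (rule sum.cong[OF refl])
    fix i
    have "inj_on (\<lambda>(A, B). A @ r # B) (?S i)"
    proof (rule inj_onI)
      fix p q assume pq: "p \<in> ?S i" "q \<in> ?S i" "(\<lambda>(A, B). A @ r # B) p = (\<lambda>(A, B). A @ r # B) q"
      obtain A B A' B' where AB: "p = (A, B)" "q = (A', B')" by (cases p; cases q)
      show "p = q"
        using pq no_r[of A B i] append_Cons_eq_iff[of r A B A' B'] by (simp add: AB)
    qed
    then show "(\<Sum>xs\<in>(\<lambda>(A, B). A @ r # B) ` ?S i. f xs) = (\<Sum>(A, B)\<in>?S i. f (A @ r # B))"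
      by (subst sum.reindex) (auto intro!: sum.cong)
  qed
  finally show ?thesis by (simp add: sum.cartesian_product)
qed

definition add_edge :: "bool \<Rightarrow> 'a \<Rightarrow> 'a \<Rightarrow> 'a \<times> 'a" where
  "add_edge b r c = (if b then (r, c) else (c, r))"

text \<open>The order relation between \<open>r\<close> and \<open>c\<close> depends only on how
  many entries of \<open>ys\<close> precede \<open>r\<close>. For a fixed number the weight splits
  into a factor for \<open>ys\<close> and one for \<open>zs\<close>, and the sum over the admissible
  numbers is the integral.\<close>

lemma sum_root_weight_shuffles:
  assumes "distinct ys" "distinct zs" "set ys \<inter> set zs = {}" "c \<in> set ys" "r \<in> set zs"
  shows "(\<Sum>xs | xs \<in> shuffles ys zs \<and> (case add_edge b r c of (u, v) \<Rightarrow> before xs u v).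
      root_weight h r xs) = edge_int h b (root_weight h c ys) * root_weight h r zs"
proof -
  obtain Y1 Y2 where ys: "ys = Y1 @ c # Y2" using assms(4) by (meson split_list)
  obtain Z1 Z2 where zs: "zs = Z1 @ r # Z2" using assms(5) by (meson split_list)
  define E where "E xs = (case add_edge b r c of (u, v) \<Rightarrow> before xs u v)" for xs
  have disj: "set ys \<inter> set (Z1 @ r # Z2) = {}" "r \<notin> set Z1" "r \<notin> set Z2"
    using assms zs by auto
  have rw_zs: "root_weight h r zs = split_weight h (length Z1) (length Z2)"
    unfolding zs using disj(2) by (rule root_weight_split)
  let ?I = "\<lambda>i. if b then i \<le> length Y1 else length Y1 < i"
  let ?n = "length ys"
  have c: "c \<notin> set Y1" "c \<notin> set Y2" using assms(1) by (simp_all add: ys)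
  have c_drop: "c \<in> set (drop i ys) \<longleftrightarrow> i \<le> length Y1" for i
  proof (cases "i \<le> length Y1")
    case False
    then have "drop i ys = drop (i - length Y1 - 1) Y2"
      by (cases "i - length Y1") (simp_all add: ys)
    with False c(2) show ?thesis by (metis in_set_dropD)
  qed (simp add: ys)
  have c_take: "c \<in> set (take i ys) \<longleftrightarrow> length Y1 < i" for i
  proof (cases "length Y1 < i")
    case True
    then show ?thesis by (cases "i - length Y1") (simp_all add: ys)
  next
    case False
    then have "take i ys = take i Y1" by (simp add: ys)
    with False c(1) show ?thesis by (metis in_set_takeD)
  qed
  have inner: "(\<Sum>A\<in>shuffles (take i ys) Z1. \<Sum>B\<in>shuffles (drop i ys) Z2.
        if E (A @ r # B) then root_weight h r (A @ r # B) else 0) =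
      (if ?I i then split_weight h i (?n - i) * root_weight h r zs else 0)" if i: "i \<le> ?n" for i
  proof -
    have AB: "(if E (A @ r # B) then root_weight h r (A @ r # B) else 0) =
       (if ?I i then split_weight h (i + length Z1) (?n - i + length Z2) else 0)"
      if "A \<in> shuffles (take i ys) Z1" "B \<in> shuffles (drop i ys) Z2" for A B
    proof -
      have sets: "set A = set (take i ys) \<union> set Z1" "set B = set (drop i ys) \<union> set Z2"
        using that by (simp_all add: set_shuffles)
      have "A @ r # B \<in> shuffles ys zs"
        unfolding zs shuffles_split[OF disj] using that i by (intro UN_I[of i]) auto
      then have dist: "distinct (A @ r # B)"
        by (rule distinct_disjoint_shuffles[OF assms(1-3)])
      moreover have "c \<notin> set Z1" "c \<notin> set Z2" using assms zs by auto
      ultimately have "E (A @ r # B) \<longleftrightarrow> ?I i"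
        unfolding E_def add_edge_def by (simp add: before_split before_split' sets c_drop c_take)
      moreover have "length A = i + length Z1" "length B = ?n - i + length Z2"
        using that i length_shuffles[of A "take i ys" Z1] length_shuffles[of B "drop i ys" Z2]
        by simp_all
      ultimately show ?thesis
        using dist by (simp add: root_weight_split)
    qed
    have cards: "card (shuffles (take i ys) Z1) = (i + length Z1 choose i)"
      "card (shuffles (drop i ys) Z2) = (?n - i + length Z2 choose (?n - i))"
    proof -
      have "set (take i ys) \<inter> set Z1 = {}" "set (drop i ys) \<inter> set Z2 = {}"
        using disj set_take_subset[of i ys] set_drop_subset[of i ys] by auto
      with i show "card (shuffles (take i ys) Z1) = (i + length Z1 choose i)"
        "card (shuffles (drop i ys) Z2) = (?n - i + length Z2 choose (?n - i))"
        by (simp_all add: card_disjoint_shuffles)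
    qed
    \<comment> \<open>The binomial coefficients count the shuffles on either side of
      \<open>r\<close>; the product rule of divided powers absorbs them and separates
      \<open>ys\<close> from \<open>zs\<close>.\<close>
    have "of_nat (i + length Z1 choose i) * (of_nat (?n - i + length Z2 choose (?n - i)) *
        split_weight h (i + length Z1) (?n - i + length Z2)) =
        (of_nat (i + length Z1 choose i) * divpow [:h, -1:] (i + length Z1)) *
        (of_nat (?n - i + length Z2 choose (?n - i)) * divpow pvar (?n - i + length Z2))"
      by (simp add: split_weight_def)
    also have "\<dots> = split_weight h i (?n - i) * root_weight h r zs"
      by (simp only: divpow_mult[symmetric] rw_zs) (simp add: split_weight_def)
    finally show ?thesis by (simp add: AB cards)
  qed
  have "(\<Sum>xs | xs \<in> shuffles ys zs \<and> E xs. root_weight h r xs) =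
      (\<Sum>xs\<in>shuffles ys zs. if E xs then root_weight h r xs else 0)"
    by (intro sum.mono_neutral_cong_left) auto
  also have "\<dots> = (\<Sum>i\<le>?n. if ?I i then split_weight h i (?n - i) * root_weight h r zs else 0)"
    unfolding zs sum_shuffles_split[OF disj] using inner zs by (intro sum.cong) auto
  also have "\<dots> = (\<Sum>i | i \<le> ?n \<and> ?I i. split_weight h i (?n - i)) * root_weight h r zs"
    unfolding sum_distrib_right by (intro sum.mono_neutral_cong_right) auto
  also have "(\<Sum>i | i \<le> ?n \<and> ?I i. split_weight h i (?n - i)) =
      edge_int h b (root_weight h c ys)"
    using assms(1) unfolding ys by (simp add: root_weight_split edge_int_split_weight)
  finally show ?thesis by (simp add: E_def)
qed

definition poset_volume :: "real \<Rightarrow> 'a \<Rightarrow> 'a set \<Rightarrow> 'a rel \<Rightarrow> real poly" where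
  "poset_volume h r V E = (\<Sum>xs\<in>lin_exts V E. root_weight h r xs)"

text \<open>Restricting a linear extension of the joined poset to \<open>V\<close> and to
  \<open>W\<close> gives linear extensions of both parts; the fibers are the shuffles that respect
  the one new relation.\<close>

theorem poset_volume_join:
  assumes "finite V" "finite W" "V \<inter> W = {}" "c \<in> V" "r \<in> W"
    and E: "E \<subseteq> V \<times> V" and F: "F \<subseteq> W \<times> W"
  shows "poset_volume h r (V \<union> W) (insert (add_edge b r c) (E \<union> F)) =
    edge_int h b (poset_volume h c V E) * poset_volume h r W F"
proof -
  let ?S = "lin_exts (V \<union> W) (insert (add_edge b r c) (E \<union> F))"
  let ?T = "lin_exts V E \<times> lin_exts W F"
  let ?f = "\<lambda>xs. (filter (\<lambda>x. x \<in> V) xs, filter (\<lambda>x. x \<notin> V) xs)"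
  have bE: "before (filter (\<lambda>x. x \<in> V) xs) u v \<longleftrightarrow> before xs u v" if "(u, v) \<in> E" for xs u v
    using that E by (intro before_filter) auto
  have bF: "before (filter (\<lambda>x. x \<notin> V) xs) u v \<longleftrightarrow> before xs u v" if "(u, v) \<in> F" for xs u v
    using that F assms(3) by (intro before_filter) auto
  have fT: "?f ` ?S \<subseteq> ?T"
  proof (rule image_subsetI)
    fix xs assume that: "xs \<in> ?S"
    have xs: "distinct xs" "set xs = V \<union> W"
      and "\<And>e. e \<in> E \<Longrightarrow> before xs (fst e) (snd e)"
        "\<And>e. e \<in> F \<Longrightarrow> before xs (fst e) (snd e)"
      using that by (auto simp: lin_exts_def split_beta)
    then have "before xs u v" if "(u, v) \<in> E" for u v using that by force
    with xs assms(3) bE[of _ _ xs] have "filter (\<lambda>x. x \<in> V) xs \<in> lin_exts V E"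
      by (auto simp: lin_exts_def)
    moreover have "before xs u v" if "(u, v) \<in> F" for u v
      using that \<open>\<And>e. e \<in> F \<Longrightarrow> before xs (fst e) (snd e)\<close> by force
    with xs assms(3) bF[of _ _ xs] have "filter (\<lambda>x. x \<notin> V) xs \<in> lin_exts W F"
      by (auto simp: lin_exts_def)
    ultimately show "?f xs \<in> ?T" by simp
  qed
  have fiber: "{xs \<in> ?S. ?f xs = (ys, zs)} =
      {xs. xs \<in> shuffles ys zs \<and> (case add_edge b r c of (u, v) \<Rightarrow> before xs u v)}"
    if "ys \<in> lin_exts V E" "zs \<in> lin_exts W F" for ys zs
  proof (rule set_eqI)
    fix xs
    have ys: "distinct ys" "set ys = V" "\<forall>(u, v)\<in>E. before ys u v"
      and zs: "distinct zs" "set zs = W" "\<forall>(u, v)\<in>F. before zs u v"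
      using that by (auto simp: lin_exts_def)
    have sh: "?f xs = (ys, zs)" if "xs \<in> shuffles ys zs"
      using filter_shuffles_disjoint1[OF _ that] assms(3) ys zs by simp
    have "xs \<in> ?S" if "xs \<in> shuffles ys zs" "case add_edge b r c of (u, v) \<Rightarrow> before xs u v"
    proof -
      have "set xs = V \<union> W" "distinct xs"
        using that(1) ys zs assms(3) distinct_disjoint_shuffles[of ys zs xs]
        by (auto dest: set_shuffles)
      moreover have "\<forall>(u, v)\<in>E. before xs u v" "\<forall>(u, v)\<in>F. before xs u v"
        using sh[OF that(1)] ys(3) zs(3) bE[of _ _ xs] bF[of _ _ xs] by auto
      ultimately show ?thesis using that(2) by (auto simp: lin_exts_def)
    qed
    moreover have "xs \<in> shuffles ys zs" if "?f xs = (ys, zs)"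
      using partition_in_shuffles[of xs "\<lambda>x. x \<in> V"] that by simp
    moreover have "case add_edge b r c of (u, v) \<Rightarrow> before xs u v" if "xs \<in> ?S"
      using that by (auto simp: lin_exts_def)
    ultimately show "xs \<in> {xs \<in> ?S. ?f xs = (ys, zs)} \<longleftrightarrow>
        xs \<in> {xs. xs \<in> shuffles ys zs \<and> (case add_edge b r c of (u, v) \<Rightarrow> before xs u v)}"
      using sh unfolding mem_Collect_eq by satx
  qed
  have "poset_volume h r (V \<union> W) (insert (add_edge b r c) (E \<union> F)) =
      (\<Sum>p\<in>?T. \<Sum>xs | xs \<in> ?S \<and> ?f xs = p. root_weight h r xs)"
    unfolding poset_volume_def
    using assms(1,2) by (intro sum.group[symmetric] fT finite_cartesian_product finite_lin_exts) auto
  also have "\<dots> = (\<Sum>(ys, zs)\<in>?T. edge_int h b (root_weight h c ys) * root_weight h r zs)"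
  proof (rule sum.cong[OF refl], safe)
    fix ys zs assume yz: "ys \<in> lin_exts V E" "zs \<in> lin_exts W F"
    then have "distinct ys" "distinct zs" "set ys = V" "set zs = W"
      by (auto simp: lin_exts_def)
    with assms show "(\<Sum>xs | xs \<in> ?S \<and> ?f xs = (ys, zs). root_weight h r xs) =
        edge_int h b (root_weight h c ys) * root_weight h r zs"
      unfolding fiber[OF yz] by (intro sum_root_weight_shuffles) auto
  qed
  also have "\<dots> = edge_int h b (poset_volume h c V E) * poset_volume h r W F"
    by (simp add: poset_volume_def edge_int_sum sum_product sum.cartesian_product)
  finally show ?thesis .
qed

section \<open>Contours of glued trees\<close>


text \<open>
  The kernel of \<open>f\<close> on the path \<open>k, \<dots>, k + length (contour t)\<close> is the gluing along \<open>t\<close>; the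
  last vertex of the path stands for \<open>v\<^sub>1\<close> again.
\<close>

fun glued :: "nat \<Rightarrow> ptree \<Rightarrow> (nat \<Rightarrow> 'a) \<Rightarrow> bool" where
  "glued k Leaf f \<longleftrightarrow> True"
| "glued k (Node b s t) f \<longleftrightarrow>
     (let j = Suc k + length (contour s) in
       glued (Suc k) s f \<and> glued (Suc j) t f \<and> f k = f (Suc j) \<and>
       f ` {Suc k..j} \<inter> f ` {Suc j..Suc j + length (contour t)} = {})"

lemma glued_closed: "glued k t f \<Longrightarrow> f (k + length (contour t)) = f k"
proof (induction k t f rule: glued.induct)
  case (2 k b s t f)
  then show ?case by (auto simp: Let_def algebra_simps)
qed simp

definition edge_rel :: "nat \<Rightarrow> int list \<Rightarrow> (nat \<Rightarrow> 'a) \<Rightarrow> 'a rel" where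
  "edge_rel k w f = (\<lambda>i. add_edge (w ! i = 1) (f (k + i)) (f (Suc (k + i)))) ` {..<length w}"

lemma edge_rel_Nil [simp]: "edge_rel k [] f = {}"
  by (simp add: edge_rel_def)

lemma edge_rel_Cons:
  "edge_rel k (c # w) f = insert (add_edge (c = 1) (f k) (f (Suc k))) (edge_rel (Suc k) w f)"
  by (simp add: edge_rel_def lessThan_Suc_eq_insert_0 image_image)

lemma edge_rel_append:
  "edge_rel k (u @ v) f = edge_rel k u f \<union> edge_rel (k + length u) v f"
  by (induction u arbitrary: k) (auto simp: edge_rel_Cons)

lemma edge_rel_subset:
  "edge_rel k w f \<subseteq> f ` {k..k + length w} \<times> f ` {k..k + length w}"
  by (auto simp: edge_rel_def add_edge_def)

lemma node_interval: "{k..Suc j + n} = insert k ({Suc k..j} \<union> {Suc j..Suc j + n})"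
  if "k \<le> j" for k j n :: nat
  using that by auto

theorem poset_volume_glued:
  "glued k t f \<Longrightarrow>
     poset_volume h (f k) (f ` {k..k + length (contour t)}) (edge_rel k (contour t) f) =
     tree_volume h t"
proof (induction k t f rule: glued.induct)
  case (1 k f)
  have "lin_exts {f k} {} = {[f k]}"
  proof -
    have "xs = [x]" if "distinct xs" "set xs = {x}" for xs and x :: 'a
      using that by (metis distinct_card card.empty card_insert_disjoint empty_iff finite.emptyI
          length_0_conv length_Suc_conv list.set_intros(1) singletonD)
    then show ?thesis by (auto simp: lin_exts_def)
  qed
  then show ?case
    using root_weight_split[of "f k" "[]" h "[]"]
    by (simp add: poset_volume_def split_weight_def)
next
  case (2 k b s t f)
  define j where "j = Suc k + length (contour s)"
  have g: "glued (Suc k) s f" "glued (Suc j) t f" "f k = f (Suc j)"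
    "f ` {Suc k..j} \<inter> f ` {Suc j..Suc j + length (contour t)} = {}"
    using "2.prems" by (simp_all add: Let_def j_def)
  have fj: "f j = f (Suc k)" using glued_closed[OF g(1)] by (simp add: j_def)
  have "contour (Node b s t) = sgn_of b # contour s @ - sgn_of b # contour t"
    by simp
  then have "edge_rel k (contour (Node b s t)) f =
      insert (add_edge b (f k) (f (Suc k))) (edge_rel (Suc k) (contour s) f \<union>
        insert (add_edge (\<not> b) (f j) (f (Suc j))) (edge_rel (Suc j) (contour t) f))"
    by (simp only: edge_rel_Cons edge_rel_append j_def) (simp add: sgn_of_def)
  \<comment> \<open>The first edge is walked back at position \<open>j\<close> in the opposite
    direction and with the opposite sign, so both passages give the same relation.\<close>
  moreover have "add_edge (\<not> b) (f j) (f (Suc j)) = add_edge b (f k) (f (Suc k))"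
    using g(3) fj by (simp add: add_edge_def)
  ultimately have E: "edge_rel k (contour (Node b s t)) f =
      insert (add_edge b (f (Suc j)) (f (Suc k)))
        (edge_rel (Suc k) (contour s) f \<union> edge_rel (Suc j) (contour t) f)"
    using g(3) by auto
  have len: "k + length (contour (Node b s t)) = Suc j + length (contour t)" by (simp add: j_def)
  have "f ` {k..k + length (contour (Node b s t))} =
      f ` {k..Suc j + length (contour t)}" by (simp only: len)
  also have "\<dots> = insert (f k) (f ` {Suc k..j} \<union> f ` {Suc j..Suc j + length (contour t)})"
    by (subst node_interval) (auto simp: j_def)
  also have "\<dots> = f ` {Suc k..j} \<union> f ` {Suc j..Suc j + length (contour t)}"
    using g(3) by auto
  finally have V: "f ` {k..k + length (contour (Node b s t))} =
      f ` {Suc k..j} \<union> f ` {Suc j..Suc j + length (contour t)}" .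
  have "poset_volume h (f (Suc j)) (f ` {Suc k..j} \<union> f ` {Suc j..Suc j + length (contour t)})
      (insert (add_edge b (f (Suc j)) (f (Suc k)))
        (edge_rel (Suc k) (contour s) f \<union> edge_rel (Suc j) (contour t) f)) =
    edge_int h b (poset_volume h (f (Suc k)) (f ` {Suc k..j}) (edge_rel (Suc k) (contour s) f)) *
    poset_volume h (f (Suc j)) (f ` {Suc j..Suc j + length (contour t)})
      (edge_rel (Suc j) (contour t) f)"
    using g(4) edge_rel_subset[of "Suc k" "contour s" f] edge_rel_subset[of "Suc j" "contour t" f]
    by (intro poset_volume_join) (auto simp: j_def)
  then show ?case
    unfolding E V g(3) using "2.IH"(1)[OF j_def g(1)] "2.IH"(2)[OF j_def g(2)]
    by (simp add: j_def)
qed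

text \<open>A tree has one vertex more than edges, and each edge occurs twice in the
  contour.\<close>

lemma card_glued: "glued k t f \<Longrightarrow> 2 * card (f ` {k..k + length (contour t)}) = length (contour t) + 2"
proof (induction k t f rule: glued.induct)
  case (2 k b s t f)
  define j where "j = Suc k + length (contour s)"
  have g: "glued (Suc k) s f" "glued (Suc j) t f" "f k = f (Suc j)"
    "f ` {Suc k..j} \<inter> f ` {Suc j..Suc j + length (contour t)} = {}"
    using "2.prems" by (simp_all add: Let_def j_def)
  have len: "k + length (contour (Node b s t)) = Suc j + length (contour t)" by (simp add: j_def)
  have "f ` {k..k + length (contour (Node b s t))} =
      f ` {k..Suc j + length (contour t)}" by (simp only: len)
  also have "\<dots> = insert (f k) (f ` {Suc k..j} \<union> f ` {Suc j..Suc j + length (contour t)})"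
    by (subst node_interval) (auto simp: j_def)
  also have "\<dots> = f ` {Suc k..j} \<union> f ` {Suc j..Suc j + length (contour t)}"
    using g(3) by auto
  finally have "card (f ` {k..k + length (contour (Node b s t))}) =
      card (f ` {Suc k..j}) + card (f ` {Suc j..Suc j + length (contour t)})"
    using g(4) by (simp add: card_Un_disjoint)
  then show ?case
    using "2.IH"(1)[OF j_def g(1)] "2.IH"(2)[OF j_def g(2)] by (simp add: j_def)
qed simp

lemma glued_cong_kernel:
  assumes "\<And>x y. x \<in> {k..k + length (contour t)} \<Longrightarrow> y \<in> {k..k + length (contour t)} \<Longrightarrow>
    f x = f y \<longleftrightarrow> g x = g y"
  assumes "glued k t f"
  shows "glued k t g"
  using assms
proof (induction k t f rule: glued.induct)
  case (2 k b s t f)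
  define j where "j = Suc k + length (contour s)"
  have len: "k + length (contour (Node b s t)) = Suc j + length (contour t)" by (simp add: j_def)
  have eq: "f x = f y \<longleftrightarrow> g x = g y"
    if "x \<in> {k..Suc j + length (contour t)}" "y \<in> {k..Suc j + length (contour t)}" for x y
    using "2.prems"(1)[of x y] that unfolding len by blast
  have f: "glued (Suc k) s f" "glued (Suc j) t f" "f k = f (Suc j)"
    "f ` {Suc k..j} \<inter> f ` {Suc j..Suc j + length (contour t)} = {}"
    using "2.prems"(2) by (simp_all add: Let_def j_def)
  have "glued (Suc k) s g"
    by (rule "2.IH"(1)[OF j_def _ f(1)], rule eq) (auto simp: j_def)
  moreover have "glued (Suc j) t g"
    by (rule "2.IH"(2)[OF j_def _ f(2)], rule eq) (auto simp: j_def)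
  moreover have "g k = g (Suc j)"
    using f(3) eq[of k "Suc j"] by (simp add: j_def)
  moreover have "g ` {Suc k..j} \<inter> g ` {Suc j..Suc j + length (contour t)} = {}"
  proof -
    have "g x \<noteq> g y" if "x \<in> {Suc k..j}" "y \<in> {Suc j..Suc j + length (contour t)}" for x y
    proof -
      have "f x \<noteq> f y" using f(4) that by blast
      with eq[of x y] that show ?thesis by (simp add: j_def)
    qed
    then show ?thesis by blast
  qed
  ultimately show ?case by (simp add: Let_def j_def)
qed simp

lemma ex_glued: "\<exists>f :: nat \<Rightarrow> nat. glued k t f"
proof (induction t arbitrary: k)
  case (Node b s t)
  define j where "j = Suc k + length (contour s)"
  obtain f g :: "nat \<Rightarrow> nat" where fg: "glued (Suc k) s f" "glued (Suc j) t g"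
    using Node.IH by blast
  \<comment> \<open>Even labels for the branch and odd ones for the rest keep the two vertex sets
    disjoint; position \<open>k\<close> receives the label of the root, to which the walk returns at
    \<open>Suc j\<close>.\<close>
  define u where
    "u x = (if x = k then 2 * g (Suc j) + 1 else if x \<le> j then 2 * f x else 2 * g x + 1)" for x
  have "glued (Suc k) s u"
    by (rule glued_cong_kernel[OF _ fg(1)]) (simp add: u_def j_def)
  moreover have "glued (Suc j) t u"
    by (rule glued_cong_kernel[OF _ fg(2)]) (simp add: u_def j_def)
  moreover have "u k = u (Suc j)" by (simp add: u_def j_def)
  moreover have "u ` {Suc k..j} \<inter> u ` {Suc j..Suc j + length (contour t)} = {}"
  proof -
    have "u x \<noteq> u y" if "x \<in> {Suc k..j}" "y \<in> {Suc j..Suc j + length (contour t)}" for x y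
    proof -
      have "u x = 2 * f x" "u y = 2 * g y + 1"
        using that by (simp_all add: u_def j_def)
      then show ?thesis by presburger
    qed
    then show ?thesis by blast
  qed
  ultimately have "glued k (Node b s t) u" by (simp add: Let_def j_def)
  then show ?case by blast
next
  case Leaf
  show ?case by (rule exI[of _ id]) simp
qed

fun pairing :: "nat \<Rightarrow> ptree \<Rightarrow> nat set set" where
  "pairing k Leaf = {}"
| "pairing k (Node b s t) =
     (let j = Suc k + length (contour s) in insert {k, j} (pairing (Suc k) s \<union> pairing (Suc j) t))"

text \<open>Minimality of the gluing: \<open>f\<close> identifies only positions that every
  equivalence relation containing the glued pairs identifies. Together with
  \<open>glued_pairing\<close> it characterizes the kernel of \<open>f\<close>.\<close>

lemma glued_kernel:
  assumes "glued k t f" "symp Q" "transp Q" "reflp Q"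
    and "\<And>i j. {i, j} \<in> pairing k t \<Longrightarrow> Q i (Suc j)"
    and "x \<in> {k..k + length (contour t)}" "y \<in> {k..k + length (contour t)}" "f x = f y"
  shows "Q x y"
  using assms(1,5-8)
proof (induction k t f arbitrary: x y rule: glued.induct)
  case (1 k f)
  then show ?case using assms(4) by (simp add: reflpD)
next
  case (2 k b s t f)
  define j where "j = Suc k + length (contour s)"
  have len: "k + length (contour (Node b s t)) = Suc j + length (contour t)" by (simp add: j_def)
  have f: "glued (Suc k) s f" "glued (Suc j) t f" "f k = f (Suc j)"
    "f ` {Suc k..j} \<inter> f ` {Suc j..Suc j + length (contour t)} = {}"
    using "2.prems"(1) by (simp_all add: Let_def j_def)
  have Q: "Q p (Suc q)" if "{p, q} = {k, j} \<or> {p, q} \<in> pairing (Suc k) s \<or>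
      {p, q} \<in> pairing (Suc j) t" for p q
    using "2.prems"(2)[of p q] that
    unfolding pairing.simps Let_def j_def[symmetric] insert_iff Un_iff by satx
  have inner: "Q x y" if "x \<in> {Suc k..j}" "y \<in> {Suc k..j}" "f x = f y" for x y
  proof (rule "2.IH"(1)[OF j_def f(1)])
    show "Q p (Suc q)" if "{p, q} \<in> pairing (Suc k) s" for p q using Q that by blast
  qed (use that in \<open>simp_all add: j_def\<close>)
  have outer: "Q x y" if "x \<in> {Suc j..Suc j + length (contour t)}"
      "y \<in> {Suc j..Suc j + length (contour t)}" "f x = f y" for x y
  proof (rule "2.IH"(2)[OF j_def f(2)])
    show "Q p (Suc q)" if "{p, q} \<in> pairing (Suc j) t" for p q using Q that by blast
  qed (use that in simp_all)
  \<comment> \<open>Replacing position \<open>k\<close> by \<open>Suc j\<close>, which is the same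
    vertex, puts every position into the path of the branch or into that of the rest, where the
    induction hypotheses apply.\<close>
  define r where "r z = (if z = k then Suc j else z)" for z
  have r1: "Q z (r z)" for z
    using Q[of k j] reflpD[OF assms(4)] by (simp add: r_def)
  have r2: "Q (r z) z" for z
    using r1 by (rule sympD[OF assms(2)])
  have r3: "f (r z) = f z" for z
    using f(3) by (simp add: r_def)
  have range: "r z \<in> {Suc k..j} \<or> r z \<in> {Suc j..Suc j + length (contour t)}"
    if "z \<in> {k..Suc j + length (contour t)}" for z
    using that by (auto simp: r_def)
  have "Q (r x) (r y)"
  proof -
    have "f (r x) = f (r y)" using "2.prems"(5) by (simp add: r3)
    moreover have "f u \<noteq> f v" if "u \<in> {Suc k..j}" "v \<in> {Suc j..Suc j + length (contour t)}" for u v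
      using f(4) that by blast
    ultimately have "\<not> (r x \<in> {Suc k..j} \<and> r y \<in> {Suc j..Suc j + length (contour t)})"
      "\<not> (r y \<in> {Suc k..j} \<and> r x \<in> {Suc j..Suc j + length (contour t)})"
      by metis+
    with \<open>f (r x) = f (r y)\<close> show ?thesis
      using range[of x] range[of y] "2.prems"(3,4) inner[of "r x" "r y"] outer[of "r x" "r y"]
      unfolding len by satx
  qed
  then show ?case
    using r1[of x] r2[of y] transpD[OF assms(3)] by blast
qed

lemma glued_pairing:
  "glued k t f \<Longrightarrow> {i, j} \<in> pairing k t \<Longrightarrow> f i = f (Suc j)"
proof (induction k t f rule: glued.induct)
  case (2 k b s t f)
  define m where "m = Suc k + length (contour s)"
  have f: "glued (Suc k) s f" "glued (Suc m) t f" "f k = f (Suc m)"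
    using "2.prems"(1) by (simp_all add: Let_def m_def)
  have fm: "f m = f (Suc k)" using glued_closed[OF f(1)] by (simp add: m_def)
  have "{i, j} = {k, m} \<or> {i, j} \<in> pairing (Suc k) s \<or> {i, j} \<in> pairing (Suc m) t"
    using "2.prems"(2) unfolding pairing.simps Let_def m_def[symmetric] insert_iff Un_iff .
  then consider "{i, j} = {k, m}" | "{i, j} \<in> pairing (Suc k) s"
    | "{i, j} \<in> pairing (Suc m) t" by satx
  then show ?case
  proof cases
    case 1
    then have "i = k \<and> j = m \<or> i = m \<and> j = k" by (simp add: doubleton_eq_iff)
    with f(3) fm show ?thesis by auto
  next
    case 2
    then show ?thesis using "2.IH"(1)[OF m_def f(1)] by blast
  next
    case 3
    then show ?thesis using "2.IH"(2)[OF m_def f(2)] by blast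
  qed
qed simp

section \<open>Non-crossing pairings as plane trees\<close>


text \<open>The edges are numbered from an arbitrary \<open>k\<close>, so that the parts of a
  pairing on subintervals have the same form as the whole.\<close>

definition compatible_from :: "nat \<Rightarrow> int list \<Rightarrow> nat set set \<Rightarrow> bool" where
  "compatible_from k w \<sigma> \<longleftrightarrow> partition_on {k..<k + length w} \<sigma> \<and> (\<forall>B\<in>\<sigma>. card B = 2) \<and>
     (\<forall>i j. {i, j} \<in> \<sigma> \<longrightarrow> w ! (i - k) + w ! (j - k) = 0) \<and> noncrossing \<sigma>"

lemma compatible_fromI:
  assumes "\<Union>\<sigma> = {k..<k + length w}" "disjoint \<sigma>" "{} \<notin> \<sigma>" "\<forall>B\<in>\<sigma>. card B = 2"
    "\<And>i j. {i, j} \<in> \<sigma> \<Longrightarrow> w ! (i - k) + w ! (j - k) = 0" "noncrossing \<sigma>"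
  shows "compatible_from k w \<sigma>"
  using assms unfolding compatible_from_def partition_on_def by blast

lemma compatible_fromD:
  assumes "compatible_from k w \<sigma>"
  shows "\<Union>\<sigma> = {k..<k + length w}" "disjoint \<sigma>" "{} \<notin> \<sigma>" "\<And>B. B \<in> \<sigma> \<Longrightarrow> card B = 2"
    "\<And>i j. {i, j} \<in> \<sigma> \<Longrightarrow> w ! (i - k) + w ! (j - k) = 0" "noncrossing \<sigma>"
  using assms unfolding compatible_from_def partition_on_def by blast+

lemma compatible_from_1:
  "compatible_from 1 e \<sigma> \<longleftrightarrow>
     is_pairing (length e) \<sigma> \<and> compatible_pairing e \<sigma> \<and> noncrossing \<sigma>"
proof -
  have "{1..<1 + length e} = {1..length e}" by auto
  then show ?thesis
    by (auto simp: compatible_from_def is_pairing_def compatible_pairing_def sign_def)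
qed

lemma compatible_from_subset:
  "compatible_from k w \<sigma> \<Longrightarrow> B \<in> \<sigma> \<Longrightarrow> B \<subseteq> {k..<k + length w}"
  by (auto simp: compatible_from_def partition_on_def)

lemma compatible_from_Nil: "compatible_from k [] \<sigma> \<longleftrightarrow> \<sigma> = {}"
  by (auto simp: compatible_from_def partition_on_empty noncrossing_def)

lemma compatible_from_Node:
  assumes \<sigma>: "compatible_from (Suc k) u \<sigma>" and \<tau>: "compatible_from (Suc j) v \<tau>"
    and j: "j = Suc k + length u"
  shows "compatible_from k (c # u @ - c # v) (insert {k, j} (\<sigma> \<union> \<tau>))"
  unfolding compatible_from_def
proof (intro conjI allI ballI impI)
  have s: "B \<subseteq> {Suc k..<j}" if "B \<in> \<sigma>" for B
    using compatible_from_subset[OF \<sigma> that] j by simp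
  have t: "B \<subseteq> {Suc j..<Suc j + length v}" if "B \<in> \<tau>" for B
    using compatible_from_subset[OF \<tau> that] by simp
  have kj: "k < j" using j by simp
  have ps: "\<Union>\<sigma> = {Suc k..<j}" "disjoint \<sigma>" "{} \<notin> \<sigma>"
    and pt: "\<Union>\<tau> = {Suc j..<Suc j + length v}" "disjoint \<tau>" "{} \<notin> \<tau>"
    using \<sigma> \<tau> j by (simp_all add: compatible_from_def partition_on_def)
  have len: "k + length (c # u @ - c # v) = Suc j + length v" using j by simp
  show "partition_on {k..<k + length (c # u @ - c # v)} (insert {k, j} (\<sigma> \<union> \<tau>))"
    unfolding len
  proof (rule partition_onI)
    have "\<Union>(insert {k, j} (\<sigma> \<union> \<tau>)) =
        {k, j} \<union> {Suc k..<j} \<union> {Suc j..<Suc j + length v}"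
      using ps(1) pt(1) by auto
    also have "\<dots> = {k..<Suc j + length v}" using kj by auto
    finally show "\<Union>(insert {k, j} (\<sigma> \<union> \<tau>)) = {k..<Suc j + length v}" .
  next
    fix B C assume BC: "B \<in> insert {k, j} (\<sigma> \<union> \<tau>)" "C \<in> insert {k, j} (\<sigma> \<union> \<tau>)" "B \<noteq> C"
    show "disjnt B C"
    proof (rule ccontr)
      assume "\<not> disjnt B C"
      then obtain x where x: "x \<in> B" "x \<in> C" by (auto simp: disjnt_def)
      have region: "(B \<in> \<sigma> \<longleftrightarrow> x \<in> {Suc k..<j}) \<and> (B \<in> \<tau> \<longleftrightarrow> x \<in> {Suc j..<Suc j + length v})"
        if "B \<in> insert {k, j} (\<sigma> \<union> \<tau>)" "x \<in> B" for B
      proof -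
        have "B \<in> \<sigma> \<Longrightarrow> x \<in> {Suc k..<j}" "B \<in> \<tau> \<Longrightarrow> x \<in> {Suc j..<Suc j + length v}"
          "B = {k, j} \<Longrightarrow> x = k \<or> x = j"
          using s t that(2) by blast+
        with that(1) kj show ?thesis by auto
      qed
      have "B \<in> \<sigma> \<longleftrightarrow> C \<in> \<sigma>" "B \<in> \<tau> \<longleftrightarrow> C \<in> \<tau>"
        using region[OF BC(1) x(1)] region[OF BC(2) x(2)] by blast+
      then have "B \<in> \<sigma> \<and> C \<in> \<sigma> \<or> B \<in> \<tau> \<and> C \<in> \<tau>" using BC by blast
      then have "B \<inter> C = {}" using disjointD[OF ps(2)] disjointD[OF pt(2)] BC(3) by blast
      with x show False by blast
    qed
  next
    show "{} \<notin> insert {k, j} (\<sigma> \<union> \<tau>)" using ps(3) pt(3) by simp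
  qed
  show "card B = 2" if "B \<in> insert {k, j} (\<sigma> \<union> \<tau>)" for B
    using that \<sigma> \<tau> kj by (auto simp: compatible_from_def)
  let ?w = "c # u @ - c # v"
  have w: "?w ! 0 = c" "?w ! (j - k) = - c"
    using j by (simp_all add: nth_Cons')
  show "?w ! (p - k) + ?w ! (q - k) = 0"
    if "{p, q} \<in> insert {k, j} (\<sigma> \<union> \<tau>)" for p q
  proof -
    consider "p = k \<and> q = j \<or> p = j \<and> q = k" | "{p, q} \<in> \<sigma>" | "{p, q} \<in> \<tau>"
      using \<open>{p, q} \<in> insert {k, j} (\<sigma> \<union> \<tau>)\<close> by (auto simp: doubleton_eq_iff)
    then show ?thesis
    proof cases
      case 1
      then show ?thesis using w by auto
    next
      case 2
      have "?w ! (i - k) = u ! (i - Suc k)" if "i \<in> {Suc k..<j}" for i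
      proof -
        have "i - k = Suc (i - Suc k)" "i - Suc k < length u" using that j by auto
        then show ?thesis by (simp add: nth_append)
      qed
      with 2 s[OF 2] \<sigma> show ?thesis by (auto simp: compatible_from_def)
    next
      case 3
      have "?w ! (i - k) = v ! (i - Suc j)" if "i \<in> {Suc j..<Suc j + length v}" for i
      proof -
        have "i - k = Suc (length u + Suc (i - Suc j))" using that j by auto
        then show ?thesis by (simp add: nth_append)
      qed
      with 3 t[OF 3] \<tau> show ?thesis by (auto simp: compatible_from_def)
    qed
  qed
  show "noncrossing (insert {k, j} (\<sigma> \<union> \<tau>))"
    unfolding noncrossing_def
  proof (intro notI, elim exE conjE)
    fix p q x y assume *: "p < q" "q < x" "x < y"
      "{p, x} \<in> insert {k, j} (\<sigma> \<union> \<tau>)" "{q, y} \<in> insert {k, j} (\<sigma> \<union> \<tau>)"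
    have region: "a = k \<and> b = j \<or> {a, b} \<in> \<sigma> \<and> Suc k \<le> a \<and> b < j \<or> {a, b} \<in> \<tau> \<and> j < a"
      if "{a, b} \<in> insert {k, j} (\<sigma> \<union> \<tau>)" "a < b" for a b
    proof -
      have "{a, b} = {k, j} \<Longrightarrow> a = k \<and> b = j"
        using that(2) kj by (auto simp: doubleton_eq_iff)
      moreover have "{a, b} \<in> \<sigma> \<Longrightarrow> Suc k \<le> a \<and> b < j" using s[of "{a, b}"] by simp
      moreover have "{a, b} \<in> \<tau> \<Longrightarrow> j < a" using t[of "{a, b}"] by simp
      ultimately show ?thesis using that(1) by blast
    qed
    have "p = k \<and> x = j \<or> {p, x} \<in> \<sigma> \<and> Suc k \<le> p \<and> x < j \<or> {p, x} \<in> \<tau> \<and> j < p"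
      "q = k \<and> y = j \<or> {q, y} \<in> \<sigma> \<and> Suc k \<le> q \<and> y < j \<or> {q, y} \<in> \<tau> \<and> j < q"
      by (rule region; use * in simp)+
    then have "{p, x} \<in> \<sigma> \<and> {q, y} \<in> \<sigma> \<or> {p, x} \<in> \<tau> \<and> {q, y} \<in> \<tau>"
      using * kj by (elim disjE conjE) simp_all
    moreover have "noncrossing \<sigma>" "noncrossing \<tau>"
      using \<sigma> \<tau> by (simp_all add: compatible_from_def)
    ultimately show False using *(1-3) unfolding noncrossing_def by blast
  qed
qed

lemma compatible_from_pairing: "compatible_from k (contour t) (pairing k t)"
proof (induction t arbitrary: k)
  case (Node b s t)
  then show ?case
    using compatible_from_Node[OF Node.IH(1) Node.IH(2) refl, of k "sgn_of b"]
    by (simp add: Let_def)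
qed (simp add: compatible_from_Nil)

text \<open>The partner \<open>j\<close> of the first edge \<open>k\<close> is the cut: any other
  pair lies strictly between \<open>k\<close> and \<open>j\<close> or after \<open>j\<close>, for it
  would otherwise cross {k, j}.\<close>

lemma compatible_from_decompose:
  assumes \<sigma>: "compatible_from k (c # w) \<sigma>"
  obtains u v \<rho> \<tau> where "w = u @ - c # v" "compatible_from (Suc k) u \<rho>"
    "compatible_from (Suc (Suc k + length u)) v \<tau>"
    "\<sigma> = insert {k, Suc k + length u} (\<rho> \<union> \<tau>)"
proof -
  let ?n = "Suc k + length w"
  note sgn = compatible_fromD(5)[OF \<sigma>]
  have part: "\<Union>\<sigma> = {k..<?n}" "disjoint \<sigma>" "{} \<notin> \<sigma>"
    using compatible_fromD(1-3)[OF \<sigma>] by simp_all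
  note card2 = compatible_fromD(4)[OF \<sigma>] and nc = compatible_fromD(6)[OF \<sigma>]
  have pair: "\<exists>p q. B = {p, q} \<and> p < q" if "B \<in> \<sigma>" for B
  proof -
    from card2[OF that] obtain p q where "B = {p, q}" "p \<noteq> q" by (auto simp: card_2_iff)
    then have "B = {p, q} \<and> p < q \<or> B = {q, p} \<and> q < p" by auto
    then show ?thesis by blast
  qed
  have uniq: "B = C" if "B \<in> \<sigma>" "C \<in> \<sigma>" "x \<in> B" "x \<in> C" for B C x
    using disjointD[OF part(2) that(1,2)] that(3,4) by blast
  have "k \<in> \<Union>\<sigma>" using part(1) by simp
  then obtain B where B: "B \<in> \<sigma>" "k \<in> B" by blast
  then obtain p q where pq: "B = {p, q}" "p < q" using pair by blast
  have "p \<in> {k..<?n}" "q \<in> {k..<?n}" using part(1) B(1) pq(1) by blast+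
  then have "p = k" using B(2) pq by auto
  define j where "j = q"
  have kj: "{k, j} \<in> \<sigma>" "k < j" "j < ?n"
    using B pq \<open>p = k\<close> \<open>q \<in> {k..<?n}\<close> by (auto simp: j_def)
  define u where "u = take (j - Suc k) w"
  define v where "v = drop (j - k) w"
  have j: "j = Suc k + length u" using kj by (simp add: u_def)
  have "w ! (j - Suc k) = - c"
    using sgn[OF kj(1)] kj(2) by (simp add: nth_Cons')
  then have "u @ - c # v = take (j - Suc k) w @ w ! (j - Suc k) # drop (Suc (j - Suc k)) w"
    using kj(2) by (simp add: u_def v_def Suc_diff_Suc)
  also have "\<dots> = w"
    using kj by (intro id_take_nth_drop[symmetric]) simp
  finally have w: "w = u @ - c # v" by (rule sym)
  have n: "?n = Suc j + length v" using arg_cong[OF w, of length] j by simp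
  define \<rho> where "\<rho> = {B \<in> \<sigma>. B \<subseteq> {Suc k..<j}}"
  define \<tau> where "\<tau> = {B \<in> \<sigma>. B \<subseteq> {Suc j..<?n}}"
  have cases: "B = {k, j} \<or> B \<in> \<rho> \<or> B \<in> \<tau>" if "B \<in> \<sigma>" for B
  proof (rule disjCI)
    assume neq: "\<not> (B \<in> \<rho> \<or> B \<in> \<tau>)"
    show "B = {k, j}"
    proof (rule ccontr)
      assume "B \<noteq> {k, j}"
      then have "k \<notin> B" "j \<notin> B" using uniq[OF that kj(1)] by blast+
      obtain p q where pq: "B = {p, q}" "p < q" using pair \<open>B \<in> \<sigma>\<close> by blast
      have "p \<in> {k..<?n}" "q \<in> {k..<?n}" using part(1) that pq(1) by blast+
      then have range: "Suc k \<le> p" "q < ?n" "p \<noteq> j" "q \<noteq> j"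
        using \<open>k \<notin> B\<close> \<open>j \<notin> B\<close> pq by auto
      have "\<not> (p < j \<and> j < q)"
      proof -
        have "\<not> (k < p \<and> p < j \<and> j < q \<and> {k, j} \<in> \<sigma> \<and> {p, q} \<in> \<sigma>)"
          using nc unfolding noncrossing_def by blast
        then show ?thesis using range(1) kj(1) that pq(1) by auto
      qed
      then have "q < j \<or> j < p" using range(3,4) by linarith
      then have "B \<subseteq> {Suc k..<j} \<or> B \<subseteq> {Suc j..<?n}"
        using range pq by auto
      then show False using neq that by (simp add: \<rho>_def \<tau>_def)
    qed
  qed
  have sub: "\<rho> \<subseteq> \<sigma>" "\<tau> \<subseteq> \<sigma>" by (auto simp: \<rho>_def \<tau>_def)
  have \<sigma>_eq: "\<sigma> = insert {k, j} (\<rho> \<union> \<tau>)" using cases sub kj(1) by blast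
  have inherit: "disjoint \<chi>" "{} \<notin> \<chi>" "\<forall>B\<in>\<chi>. card B = 2" "noncrossing \<chi>" if "\<chi> \<subseteq> \<sigma>" for \<chi>
  proof -
    show "disjoint \<chi>" using part(2) that by (rule pairwise_subset)
    show "{} \<notin> \<chi>" "\<forall>B\<in>\<chi>. card B = 2" using part(3) card2 that by auto
    show "noncrossing \<chi>" using nc that unfolding noncrossing_def by blast
  qed
  have U\<rho>: "\<Union>\<rho> = {Suc k..<j}"
  proof
    show "{Suc k..<j} \<subseteq> \<Union>\<rho>"
    proof
      fix x assume x: "x \<in> {Suc k..<j}"
      then have "x \<in> \<Union>\<sigma>" using part(1) kj(3) by auto
      then obtain B where B: "B \<in> \<sigma>" "x \<in> B" by blast
      then have "B \<noteq> {k, j}" "B \<notin> \<tau>" using x by (auto simp: \<tau>_def)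
      then show "x \<in> \<Union>\<rho>" using cases B by blast
    qed
  qed (auto simp: \<rho>_def)
  have "u ! (i - Suc k) = (c # w) ! (i - k)" if "i \<in> {Suc k..<j}" for i
  proof -
    have "i - k = Suc (i - Suc k)" "i - Suc k < j - Suc k" using that by auto
    then show ?thesis by (simp add: u_def)
  qed
  then have "u ! (p - Suc k) + u ! (q - Suc k) = 0" if "{p, q} \<in> \<rho>" for p q
    using that sgn[of p q] by (auto simp: \<rho>_def)
  then have "compatible_from (Suc k) u \<rho>"
    using inherit[OF sub(1)] U\<rho> j by (intro compatible_fromI) simp_all
  moreover have U\<tau>: "\<Union>\<tau> = {Suc j..<?n}"
  proof
    show "{Suc j..<?n} \<subseteq> \<Union>\<tau>"
    proof
      fix x assume x: "x \<in> {Suc j..<?n}"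
      then have "x \<in> \<Union>\<sigma>" using part(1) kj(2) by auto
      then obtain B where B: "B \<in> \<sigma>" "x \<in> B" by blast
      then have "B \<noteq> {k, j}" "B \<notin> \<rho>" using x kj(2) by (auto simp: \<rho>_def)
      then show "x \<in> \<Union>\<tau>" using cases B by blast
    qed
  qed (auto simp: \<tau>_def)
  have "v ! (i - Suc j) = (c # w) ! (i - k)" if "i \<in> {Suc j..<?n}" for i
  proof -
    have "i - k = Suc (j - k + (i - Suc j))" using that kj(2) by auto
    then show ?thesis using kj(2,3) by (simp add: v_def)
  qed
  then have "v ! (p - Suc j) + v ! (q - Suc j) = 0" if "{p, q} \<in> \<tau>" for p q
    using that sgn[of p q] by (simp add: \<tau>_def)
  then have "compatible_from (Suc j) v \<tau>"
    using inherit[OF sub(2)] U\<tau> n by (intro compatible_fromI) simp_all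
  ultimately show thesis
    using that[of u v \<rho> \<tau>] w \<sigma>_eq unfolding j by blast
qed

lemma ex_pairing:
  assumes "compatible_from k w \<sigma>" "set w \<subseteq> {1, -1}"
  shows "\<exists>t. contour t = w \<and> pairing k t = \<sigma>"
  using assms
proof (induction w arbitrary: k \<sigma> rule: length_induct)
  case (1 w)
  show ?case
  proof (cases w)
    case Nil
    then show ?thesis using 1 by (intro exI[of _ Leaf]) (simp add: compatible_from_Nil)
  next
    case (Cons c x)
    then have "compatible_from k (c # x) \<sigma>" using "1.prems"(1) by simp
    then obtain u v \<rho> \<tau> where *: "x = u @ - c # v" "compatible_from (Suc k) u \<rho>"
        "compatible_from (Suc (Suc k + length u)) v \<tau>"
        "\<sigma> = insert {k, Suc k + length u} (\<rho> \<union> \<tau>)"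
      by (rule compatible_from_decompose)
    have sets: "set u \<subseteq> {1, -1}" "set v \<subseteq> {1, -1}" using "1.prems"(2) by (auto simp: Cons *(1))
    have lens: "length u < length w" "length v < length w" by (simp_all add: Cons *(1))
    obtain s t where st: "contour s = u" "pairing (Suc k) s = \<rho>"
        "contour t = v" "pairing (Suc (Suc k + length u)) t = \<tau>"
      using "1.IH" lens sets *(2,3) by metis
    obtain b where "c = sgn_of b"
      using "1.prems"(2) that[of True] that[of False] by (auto simp: Cons sgn_of_def)
    with st * Cons show ?thesis by (intro exI[of _ "Node b s t"]) simp
  qed
qed

text \<open>The partner of the first edge determines the length of the first branch; the pairs
  inside and after it then determine the two subtrees. The directions are read off the
  contour.\<close>

lemma pairing_inj:
  "contour t = contour t' \<Longrightarrow> pairing k t = pairing k t' \<Longrightarrow> t = t'"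
proof (induction t arbitrary: t' k)
  case Leaf
  then show ?case by (cases t') auto
next
  case (Node b s t)
  obtain b' s' r' where t': "t' = Node b' s' r'" using Node.prems(1) by (cases t') auto
  define j where "j = Suc k + length (contour s)"
  define j' where "j' = Suc k + length (contour s')"
  let ?\<sigma> = "pairing k (Node b s t)"
  have \<sigma>: "?\<sigma> = insert {k, j} (pairing (Suc k) s \<union> pairing (Suc j) t)"
    by (simp add: j_def)
  have \<sigma>': "?\<sigma> = insert {k, j'} (pairing (Suc k) s' \<union> pairing (Suc j') r')"
    using Node.prems(2) by (simp add: t' j'_def)
  have "disjoint ?\<sigma>"
    using compatible_from_pairing[of k "Node b s t"] by (simp add: compatible_from_def partition_on_def)
  moreover have "{k, j} \<in> ?\<sigma>" "{k, j'} \<in> ?\<sigma>" using \<sigma> \<sigma>' by blast+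
  ultimately have "{k, j} = {k, j'}" using disjointD[of ?\<sigma> "{k, j}" "{k, j'}"] by blast
  then have jj: "j' = j" by (auto simp: doubleton_eq_iff j_def j'_def)
  then have "length (contour s) = length (contour s')" by (simp add: j_def j'_def)
  then have c: "sgn_of b = sgn_of b'" "contour s = contour s'" "contour t = contour r'"
    using Node.prems(1) by (simp_all add: t')
  have subs: "B \<subseteq> {Suc k..<j} \<and> B \<noteq> {}" if "B \<in> pairing (Suc k) x" "contour x = contour s" for B x
    using compatible_from_subset[OF compatible_from_pairing that(1)] that compatible_from_pairing[of "Suc k" x]
    by (auto simp: j_def compatible_from_def partition_on_def)
  have subt: "B \<subseteq> {Suc j..} \<and> B \<noteq> {}" if "B \<in> pairing (Suc j) x" for B x
    using compatible_from_subset[OF compatible_from_pairing that] that compatible_from_pairing[of "Suc j" x]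
    by (auto simp: compatible_from_def partition_on_def)
  have kj: "k < j" by (simp add: j_def)
  have "pairing (Suc k) s = {B \<in> ?\<sigma>. B \<subseteq> {Suc k..<j} \<and> B \<noteq> {}}"
    unfolding \<sigma> using subs[of _ s] subt[of _ t] kj by fastforce
  moreover have "pairing (Suc k) s' = {B \<in> ?\<sigma>. B \<subseteq> {Suc k..<j} \<and> B \<noteq> {}}"
    unfolding \<sigma>' jj using subs[of _ s'] subt[of _ r'] kj c(2) by fastforce
  moreover have "pairing (Suc j) t = {B \<in> ?\<sigma>. B \<subseteq> {Suc j..} \<and> B \<noteq> {}}"
    unfolding \<sigma> using subs[of _ s] subt[of _ t] kj by fastforce
  moreover have "pairing (Suc j) r' = {B \<in> ?\<sigma>. B \<subseteq> {Suc j..} \<and> B \<noteq> {}}"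
    unfolding \<sigma>' jj using subs[of _ s'] subt[of _ r'] kj c(2) by fastforce
  ultimately have "s = s'" "t = r'"
    using Node.IH c(2,3) by metis+
  with c(1) show ?case by (simp add: t' sgn_of_def split: if_splits)
qed

section \<open>Quotient trees with compatible orders\<close>


text \<open>The polygon is cut open at v_1 into a path of \<open>length e + 1\<close> positions, the
  last of which is v_1 again; thus the walk around the tree needs no cyclic indices.\<close>

definition path_class :: "int list \<Rightarrow> nat set set \<Rightarrow> nat \<Rightarrow> nat set" where
  "path_class e \<sigma> i = vclass (length e) \<sigma> (if i = Suc (length e) then 1 else i)"

text \<open>Each generating pair is identified by \<open>f\<close>, which gives one direction. For
  the other, \<open>glued_kernel\<close> is applied to the generated equivalence, pulled back along
  the map that closes the path to the polygon.\<close>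

lemma glue_rel_iff:
  assumes "glued 1 t f" "\<sigma> = pairing 1 t" "e = contour t"
    and "x \<in> polygon_verts (length e)" "y \<in> polygon_verts (length e)"
  shows "(x, y) \<in> glue_rel (length e) \<sigma> \<longleftrightarrow> f x = f y"
proof
  let ?n = "length e"
  let ?G = "glued_pairs ?n \<sigma> \<union> (glued_pairs ?n \<sigma>)\<inverse>"
  have closed: "f (Suc ?n) = f 1" using glued_closed[OF assms(1)] assms(3) by simp
  have range: "i \<in> {1..?n}" if "{i, j} \<in> \<sigma>" for i j
  proof -
    have "{i, j} \<subseteq> {1..<1 + ?n}"
      using compatible_from_subset[OF compatible_from_pairing] that assms(2,3) by blast
    then show ?thesis by auto
  qed
  {
    assume "(x, y) \<in> glue_rel ?n \<sigma>"
    then have "(x, y) \<in> ?G\<^sup>*" by (simp add: glue_rel_def)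
    then show "f x = f y"
    proof (induction rule: rtrancl_induct)
      case (step y z)
      have "f i = f (next_vert ?n j)" if "{i, j} \<in> \<sigma>" for i j
        using glued_pairing[OF assms(1)] that assms(2) closed
        by (auto simp: next_vert_def)
      then have "f y = f z" using step.hyps(2) by (auto simp: glued_pairs_def)
      with step.IH show ?case by simp
    qed simp
  }
  {
    assume fxy: "f x = f y"
    define r where "r i = (if i = Suc ?n then 1 else i)" for i
    define Q where "Q i j \<longleftrightarrow> (r i, r j) \<in> ?G\<^sup>*" for i j
    have "sym ?G" by (auto simp: sym_def)
    then have "sym (?G\<^sup>*)" by (rule sym_rtrancl)
    then have "symp Q" by (auto simp: Q_def symp_def dest: symD)
    moreover have "transp Q" by (auto simp: Q_def transp_def)
    moreover have "reflp Q" by (auto simp: Q_def reflp_def)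
    moreover have "Q i (Suc j)" if "{i, j} \<in> pairing 1 t" for i j
    proof -
      have "{i, j} \<in> \<sigma>" "{j, i} \<in> \<sigma>" using that assms(2) by (simp_all add: insert_commute)
      then have "i \<noteq> Suc ?n" using range by fastforce
      then have "r i = i" "r (Suc j) = next_vert ?n j" by (auto simp: r_def next_vert_def)
      with \<open>{i, j} \<in> \<sigma>\<close> show ?thesis by (auto simp: Q_def glued_pairs_def)
    qed
    moreover have xy: "x \<in> {1..1 + length (contour t)}" "y \<in> {1..1 + length (contour t)}"
      using assms(3-5) by (auto simp: polygon_verts_def)
    ultimately have "Q x y"
      using glued_kernel[OF assms(1)] fxy by blast
    moreover have "r z = z" if "z \<in> polygon_verts ?n" for z
      using that by (cases "?n = 0") (auto simp: r_def polygon_verts_def max_def split: if_splits)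
    ultimately show "(x, y) \<in> glue_rel ?n \<sigma>"
      using assms(4,5) by (auto simp: Q_def glue_rel_def)
  }
qed

lemma vclass_eq_iff:
  assumes "glued 1 t f" "\<sigma> = pairing 1 t" "e = contour t"
    and "x \<in> polygon_verts (length e)" "y \<in> polygon_verts (length e)"
  shows "vclass (length e) \<sigma> x = vclass (length e) \<sigma> y \<longleftrightarrow> f x = f y"
proof -
  have *: "vclass (length e) \<sigma> x = {z \<in> polygon_verts (length e). f x = f z}"
    if "x \<in> polygon_verts (length e)" for x
    using glue_rel_iff[OF assms(1-3) that] by (auto simp: vclass_def glue_rel_def)
  show ?thesis using assms(4,5) by (auto simp: *)
qed

lemma path_class_in: "i \<in> {1..Suc n} \<Longrightarrow> (if i = Suc n then 1 else i) \<in> polygon_verts n"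
  by (auto simp: polygon_verts_def)

lemma glued_path_class:
  assumes "\<sigma> = pairing 1 t" "e = contour t"
  shows "glued 1 t (path_class e \<sigma>)"
proof -
  obtain f :: "nat \<Rightarrow> nat" where f: "glued 1 t f" using ex_glued by blast
  have closed: "f (Suc (length e)) = f 1" using glued_closed[OF f] assms(2) by simp
  show ?thesis
  proof (rule glued_cong_kernel[OF _ f])
    fix x y assume "x \<in> {1..1 + length (contour t)}" "y \<in> {1..1 + length (contour t)}"
    then have xy: "x \<in> {1..Suc (length e)}" "y \<in> {1..Suc (length e)}" using assms(2) by simp_all
    show "f x = f y \<longleftrightarrow> path_class e \<sigma> x = path_class e \<sigma> y"
      unfolding path_class_def
      using vclass_eq_iff[OF f assms path_class_in[OF xy(1)] path_class_in[OF xy(2)]] closed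
      by (auto split: if_splits)
  qed
qed

lemma tree_verts_path_class: "tree_verts e \<sigma> = path_class e \<sigma> ` {1..1 + length e}"
proof -
  have "{1..1 + length e} = insert (Suc (length e)) {1..length e}"
    "polygon_verts (length e) = insert 1 {1..length e}"
    by (auto simp: polygon_verts_def)
  moreover have "(\<lambda>i. if i = Suc (length e) then 1 else i) ` {1..length e} = {1..length e}"
    by (subst image_cong[OF refl, where g = id]) auto
  ultimately have "(\<lambda>i. if i = Suc (length e) then 1 else i) ` {1..1 + length e} =
      polygon_verts (length e)"
    by auto
  then have "path_class e \<sigma> ` {1..1 + length e} = vclass (length e) \<sigma> ` polygon_verts (length e)"
    unfolding path_class_def by (metis (no_types, lifting) image_cong image_image)
  then show ?thesis by (auto simp: tree_verts_def quotient_def vclass_def)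
qed

lemma tree_root_path_class: "tree_root e \<sigma> = path_class e \<sigma> 1"
  by (simp add: tree_root_def path_class_def)

text \<open>The converse appears because tree edges point from the greater to the smaller vertex,
  whereas \<open>edge_rel\<close> lists the smaller one first.\<close>

lemma tree_edges_path_class:
  assumes "set e \<subseteq> {1, -1}"
  shows "tree_edges e \<sigma> = (edge_rel 1 e (path_class e \<sigma>))\<inverse>"
proof -
  let ?f = "path_class e \<sigma>"
  let ?n = "length e"
  have f: "vclass ?n \<sigma> i = ?f i" "vclass ?n \<sigma> (next_vert ?n i) = ?f (Suc i)" if "i \<in> {1..?n}" for i
    using that by (auto simp: path_class_def next_vert_def)
  have sgn: "e ! i = -1 \<longleftrightarrow> e ! i \<noteq> 1" if "i < ?n" for i
    using assms nth_mem[OF that] by auto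
  have "(a, b) \<in> tree_edges e \<sigma> \<longleftrightarrow> (b, a) \<in> edge_rel 1 e ?f" for a b
  proof -
    have "(a, b) \<in> tree_edges e \<sigma> \<longleftrightarrow> (\<exists>i\<in>{1..?n}.
        sign e i = 1 \<and> a = vclass ?n \<sigma> (next_vert ?n i) \<and> b = vclass ?n \<sigma> i \<or>
        sign e i = -1 \<and> a = vclass ?n \<sigma> i \<and> b = vclass ?n \<sigma> (next_vert ?n i))"
      unfolding tree_edges_def Let_def by blast
    also have "\<dots> \<longleftrightarrow> (\<exists>i\<in>{1..?n}. sign e i = 1 \<and> a = ?f (Suc i) \<and> b = ?f i \<or>
        sign e i = -1 \<and> a = ?f i \<and> b = ?f (Suc i))"
      by (rule bex_cong[OF refl]) (simp only: f)
    also have "{1..?n} = Suc ` {..<?n}" by (simp add: image_Suc_lessThan)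
    also have "(\<exists>i\<in>Suc ` {..<?n}. sign e i = 1 \<and> a = ?f (Suc i) \<and> b = ?f i \<or>
        sign e i = -1 \<and> a = ?f i \<and> b = ?f (Suc i)) \<longleftrightarrow>
        (\<exists>i\<in>{..<?n}. (b, a) = add_edge (e ! i = 1) (?f (1 + i)) (?f (Suc (1 + i))))"
      unfolding bex_simps by (rule bex_cong[OF refl]) (use sgn in \<open>auto simp: sign_def add_edge_def\<close>)
    also have "\<dots> \<longleftrightarrow> (b, a) \<in> edge_rel 1 e ?f"
      unfolding edge_rel_def image_iff ..
    finally show ?thesis .
  qed
  then show ?thesis by auto
qed

section \<open>Total orders as lists, and the sum over ordered pairings\<close>

definition list_order :: "'a list \<Rightarrow> 'a rel" where
  "list_order xs = {(a, b). before xs a b}"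

lemma before_asym: "distinct xs \<Longrightarrow> before xs a b \<Longrightarrow> \<not> before xs b a"
  by (induction xs) (auto dest: before_in_set)

lemma before_trans: "distinct xs \<Longrightarrow> before xs a b \<Longrightarrow> before xs b c \<Longrightarrow> before xs a c"
  by (induction xs) (auto dest: before_in_set)

lemma before_total: "a \<in> set xs \<Longrightarrow> b \<in> set xs \<Longrightarrow> a \<noteq> b \<Longrightarrow> before xs a b \<or> before xs b a"
  by (induction xs) auto

lemma strict_linear_list_order:
  "distinct xs \<Longrightarrow> strict_linear_order_on (set xs) (list_order xs)"
  unfolding strict_linear_order_on_def list_order_def
  by (auto simp: trans_def irrefl_def total_on_def dest: before_trans before_asym before_total)

lemma sorted_wrt_before: "sorted_wrt P xs \<longleftrightarrow> (\<forall>a b. before xs a b \<longrightarrow> P a b)"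
  by (induction xs) auto

lemma increasing_list_list_order:
  assumes "distinct xs"
  shows "increasing_list (set xs) (list_order xs) = xs"
proof -
  have "set xs = set xs \<and> distinct xs \<and> sorted_wrt (\<lambda>a b. (a, b) \<in> list_order xs) xs"
    using assms by (simp add: sorted_wrt_before list_order_def)
  then show ?thesis
    unfolding increasing_list_def
    by (intro the1_equality increasing_list_ex1 strict_linear_list_order assms) auto
qed

lemma increasing_list:
  assumes "finite V" "strict_linear_order_on V R"
  shows "set (increasing_list V R) = V" "distinct (increasing_list V R)"
    "sorted_wrt (\<lambda>a b. (a, b) \<in> R) (increasing_list V R)"
  using theI'[OF increasing_list_ex1[OF assms]] by (simp_all add: increasing_list_def)

lemma list_order_increasing_list:
  assumes "finite V" "strict_linear_order_on V R" "R \<subseteq> V \<times> V"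
  shows "list_order (increasing_list V R) = R"
proof -
  let ?xs = "increasing_list V R"
  have xs: "set ?xs = V" "distinct ?xs" "\<And>a b. before ?xs a b \<Longrightarrow> (a, b) \<in> R"
    using increasing_list[OF assms(1,2)] by (auto simp: sorted_wrt_before)
  have irr: "(a, a) \<notin> R" and tr: "(a, b) \<in> R \<Longrightarrow> (b, c) \<in> R \<Longrightarrow> (a, c) \<in> R" for a b c
    using assms(2) by (auto simp: strict_linear_order_on_def irrefl_def dest: transD)
  have "before ?xs a b" if "(a, b) \<in> R" for a b
  proof -
    have "a \<in> set ?xs" "b \<in> set ?xs" "a \<noteq> b" using that assms(3) xs(1) irr by auto
    then have "before ?xs a b \<or> before ?xs b a" by (rule before_total)
    moreover have "\<not> before ?xs b a" using xs(3) that tr irr by blast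
    ultimately show ?thesis by blast
  qed
  with xs(3) show ?thesis by (auto simp: list_order_def)
qed

text \<open>An order is transitive, so it contains all directed paths as soon as it contains the
  edges.\<close>

lemma compatible_order_iff:
  assumes "set e \<subseteq> {1, -1}"
  shows "compatible_order e \<sigma> R \<longleftrightarrow> R \<subseteq> tree_verts e \<sigma> \<times> tree_verts e \<sigma> \<and>
     strict_linear_order_on (tree_verts e \<sigma>) R \<and> edge_rel 1 e (path_class e \<sigma>) \<subseteq> R"
    (is "?L \<longleftrightarrow> ?R")
proof -
  let ?V = "tree_verts e \<sigma>"
  let ?E = "edge_rel 1 e (path_class e \<sigma>)"
  have E: "tree_edges e \<sigma> = ?E\<inverse>" using assms by (rule tree_edges_path_class)
  have EV: "?E \<subseteq> ?V \<times> ?V"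
    unfolding tree_verts_path_class by (rule edge_rel_subset)
  have prec: "tree_prec e \<sigma> a b \<longleftrightarrow> (a, b) \<in> ?E\<^sup>+" for a b
    by (simp add: tree_prec_def E trancl_converse)
  have "(\<forall>a\<in>?V. \<forall>b\<in>?V. tree_prec e \<sigma> a b \<longrightarrow> (a, b) \<in> R) \<longleftrightarrow> ?E \<subseteq> R" if "trans R"
  proof
    assume "\<forall>a\<in>?V. \<forall>b\<in>?V. tree_prec e \<sigma> a b \<longrightarrow> (a, b) \<in> R"
    then show "?E \<subseteq> R" using EV prec by (auto intro: r_into_trancl)
  next
    assume "?E \<subseteq> R"
    then have "?E\<^sup>+ \<subseteq> R" using that by (metis trancl_id trancl_mono_subset)
    then show "\<forall>a\<in>?V. \<forall>b\<in>?V. tree_prec e \<sigma> a b \<longrightarrow> (a, b) \<in> R" using prec by blast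
  qed
  then show ?thesis
    unfolding compatible_order_def strict_linear_order_on_def by blast
qed

definition root_pos :: "int list \<Rightarrow> nat set set \<times> (nat set) rel \<Rightarrow> nat" where
  "root_pos e = (\<lambda>(\<sigma>, R). length (takeWhile (\<lambda>v. v \<noteq> tree_root e \<sigma>)
     (increasing_list (tree_verts e \<sigma>) R)))"

lemma sum_compatible_orders:
  assumes "set e \<subseteq> {1, -1}"
  shows "(\<Sum>R | compatible_order e \<sigma> R. f (increasing_list (tree_verts e \<sigma>) R)) =
    (\<Sum>xs\<in>lin_exts (tree_verts e \<sigma>) (edge_rel 1 e (path_class e \<sigma>)). f xs)"
proof (rule sum.reindex_bij_witness[where i = list_order
      and j = "increasing_list (tree_verts e \<sigma>)"])
  let ?V = "tree_verts e \<sigma>"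
  let ?E = "edge_rel 1 e (path_class e \<sigma>)"
  fix R assume "R \<in> {R. compatible_order e \<sigma> R}"
  then have R: "R \<subseteq> ?V \<times> ?V" "strict_linear_order_on ?V R" "?E \<subseteq> R"
    by (simp_all add: compatible_order_iff[OF assms])
  show lo: "list_order (increasing_list ?V R) = R"
    using finite_tree_verts R by (intro list_order_increasing_list)
  show "increasing_list ?V R \<in> lin_exts ?V ?E"
    using increasing_list(1,2)[OF finite_tree_verts R(2)] R(3) arg_cong[OF lo, of "\<lambda>R. ?E \<subseteq> R"]
    by (auto simp: lin_exts_def list_order_def)
next
  let ?V = "tree_verts e \<sigma>"
  let ?E = "edge_rel 1 e (path_class e \<sigma>)"
  fix xs assume "xs \<in> lin_exts ?V ?E"
  then have xs: "distinct xs" "set xs = ?V" "?E \<subseteq> list_order xs"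
    by (auto simp: lin_exts_def list_order_def)
  show "increasing_list ?V (list_order xs) = xs"
    using increasing_list_list_order[OF xs(1)] xs(2) by simp
  show "list_order xs \<in> {R. compatible_order e \<sigma> R}"
    using strict_linear_list_order[OF xs(1)] xs(2,3)
    by (auto simp: compatible_order_iff[OF assms] list_order_def dest: before_in_set)
qed simp

lemma ordered_pairings_eq:
  "ordered_pairings e = (SIGMA \<sigma>:{\<sigma>. compatible_from 1 e \<sigma>}. {R. compatible_order e \<sigma> R})"
  unfolding ordered_pairings_def compatible_from_1 by blast

lemma length_increasing_list:
  assumes "(\<sigma>, R) \<in> ordered_pairings e" "set e \<subseteq> {1, -1}"
  shows "2 * length (increasing_list (tree_verts e \<sigma>) R) = length e + 2"
proof -
  have "compatible_from 1 e \<sigma>" "compatible_order e \<sigma> R"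
    using assms(1) unfolding ordered_pairings_eq by blast+
  then obtain t where t: "contour t = e" "pairing 1 t = \<sigma>"
    using ex_pairing assms(2) by blast
  have "2 * card (tree_verts e \<sigma>) = length e + 2"
    using card_glued[OF glued_path_class[of \<sigma> t e]] t by (simp add: tree_verts_path_class)
  moreover have "strict_linear_order_on (tree_verts e \<sigma>) R"
    using \<open>compatible_order e \<sigma> R\<close> by (simp add: compatible_order_def)
  note increasing_list[OF finite_tree_verts this]
  then have "length (increasing_list (tree_verts e \<sigma>) R) = card (tree_verts e \<sigma>)"
    using distinct_card by fastforce
  ultimately show ?thesis by simp
qed

text \<open>Compatible non-crossing pairings correspond to plane trees with contour
  \<open>e\<close>, and compatible orders to linear extensions of the tree poset.\<close>

theorem sum_ordered_pairings:
  assumes "set e \<subseteq> {1, -1}" "length e = 2 * n"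
  shows "(\<Sum>x\<in>ordered_pairings e. split_weight h (root_pos e x) (n - root_pos e x)) =
    word_volume h e"
proof -
  let ?S = "{\<sigma>. compatible_from 1 e \<sigma>}"
  let ?g = "\<lambda>\<sigma> xs. split_weight h (length (takeWhile (\<lambda>v. v \<noteq> tree_root e \<sigma>) xs))
      (n - length (takeWhile (\<lambda>v. v \<noteq> tree_root e \<sigma>) xs))"
  have fin: "finite ?S"
    by (rule finite_subset[OF _ finitely_many_partition_on[of "{1..<1 + length e}"]])
      (auto simp: compatible_from_def)
  have finR: "finite {R. compatible_order e \<sigma> R}" for \<sigma>
    by (rule finite_subset[of _ "Pow (tree_verts e \<sigma> \<times> tree_verts e \<sigma>)"])
      (auto simp: compatible_order_def finite_tree_verts)
  have "(\<Sum>x\<in>ordered_pairings e. split_weight h (root_pos e x) (n - root_pos e x)) =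
      (\<Sum>\<sigma>\<in>?S. \<Sum>R | compatible_order e \<sigma> R. ?g \<sigma> (increasing_list (tree_verts e \<sigma>) R))"
    unfolding ordered_pairings_eq using fin finR
    by (subst sum.Sigma) (auto simp: root_pos_def intro!: sum.cong)
  also have "\<dots> = (\<Sum>t\<in>ptrees e. \<Sum>R | compatible_order e (pairing 1 t) R.
      ?g (pairing 1 t) (increasing_list (tree_verts e (pairing 1 t)) R))"
  proof (rule sum.reindex_bij_betw[symmetric])
    show "bij_betw (pairing 1) (ptrees e) ?S"
      unfolding bij_betw_def
    proof
      show "inj_on (pairing 1) (ptrees e)"
        by (rule inj_onI, rule pairing_inj) (simp_all add: ptrees_def)
      show "pairing 1 ` ptrees e = ?S"
        using ex_pairing[OF _ assms(1)] compatible_from_pairing[of 1]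
        by (auto simp: ptrees_def image_iff)
    qed
  qed
  also have "\<dots> = (\<Sum>t\<in>ptrees e. tree_volume h t)"
  proof (rule sum.cong[OF refl])
    fix t assume "t \<in> ptrees e"
    then have t: "e = contour t" by (simp add: ptrees_def)
    define \<sigma> where "\<sigma> = pairing 1 t"
    let ?f = "path_class e \<sigma>"
    have gl: "glued 1 t ?f" using \<sigma>_def t by (rule glued_path_class)
    have V: "tree_verts e \<sigma> = ?f ` {1..1 + length (contour t)}"
      by (simp add: tree_verts_path_class t)
    have "(\<Sum>R | compatible_order e \<sigma> R. ?g \<sigma> (increasing_list (tree_verts e \<sigma>) R)) =
        (\<Sum>xs\<in>lin_exts (tree_verts e \<sigma>) (edge_rel 1 e ?f). ?g \<sigma> xs)"
      by (rule sum_compatible_orders[OF assms(1)])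
    also have "\<dots> = poset_volume h (?f 1) (tree_verts e \<sigma>) (edge_rel 1 e ?f)"
      unfolding poset_volume_def
    proof (rule sum.cong[OF refl])
      fix xs assume "xs \<in> lin_exts (tree_verts e \<sigma>) (edge_rel 1 e ?f)"
      then have xs: "distinct xs" "set xs = tree_verts e \<sigma>" by (auto simp: lin_exts_def)
      \<comment> \<open>The tree has n + 1 vertices, so n minus the number of vertices below the
        root is the number above it.\<close>
      have "2 * card (tree_verts e \<sigma>) = 2 * n + 2"
        using card_glued[OF gl] assms(2) unfolding V t[symmetric] by simp
      then have len: "length xs = Suc n"
        using xs distinct_card by fastforce
      have "?f 1 \<in> set xs" by (simp add: xs(2) V)
      then obtain A B where AB: "xs = A @ ?f 1 # B" by (meson split_list)
      then have "?f 1 \<notin> set A" using xs(1) by simp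
      moreover have "n - length A = length B" using len AB by simp
      ultimately show "?g \<sigma> xs = root_weight h (?f 1) xs"
        by (simp add: AB root_weight_split tree_root_path_class takeWhile_append)
    qed
    also have "\<dots> = tree_volume h t"
      using poset_volume_glued[OF gl, of h] unfolding V t[symmetric] .
    finally show "(\<Sum>R | compatible_order e (pairing 1 t) R.
      ?g (pairing 1 t) (increasing_list (tree_verts e (pairing 1 t)) R)) = tree_volume h t"
      by (simp add: \<sigma>_def)
  qed
  finally show ?thesis by (simp add: word_volume_def)
qed

section \<open>Words and colorings\<close>


text \<open>Elements of the word group with nonnegative coefficients are handled as multisets, whose
  members can be counted and matched with pairings.\<close>

definition frag_sum :: "'a multiset \<Rightarrow> 'a \<Rightarrow>\<^sub>0 int" where
  "frag_sum M = (\<Sum>u\<in>#M. frag_of u)"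

lemma frag_sum_simps [simp]:
  "frag_sum {#} = 0" "frag_sum {#u#} = frag_of u" "frag_sum (M + N) = frag_sum M + frag_sum N"
  by (simp_all add: frag_sum_def)

lemma frag_sum_Sum: "frag_sum (\<Sum>x\<in>#A. f x) = (\<Sum>x\<in>#A. frag_sum (f x))"
  by (induction A) simp_all

lemma frag_extend_frag_sum: "frag_extend f (frag_sum M) = (\<Sum>u\<in>#M. f u)"
  by (induction M) (simp_all add: frag_sum_def frag_extend_add)

type_synonym word_pair = "nat list \<times> nat list"

definition pair_shuffle :: "word_pair \<Rightarrow> word_pair \<Rightarrow> word_pair multiset" where
  "pair_shuffle u v = (\<Sum>E\<in>#interleavings (fst u) (fst v).
     \<Sum>F\<in>#interleavings (snd u) (snd v). {#(E, F)#})"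

definition pair_mult :: "word_pair multiset \<Rightarrow> word_pair multiset \<Rightarrow> word_pair multiset" where
  "pair_mult M N = (\<Sum>u\<in>#M. \<Sum>v\<in>#N. pair_shuffle u v)"

lemma frag_sum_pair_mult: "frag_sum (pair_mult M N) = frag_sum M \<star> frag_sum N"
proof -
  have "frag_sum (pair_shuffle u v) = basis_mult u v" for u v
    unfolding pair_shuffle_def basis_mult_def frag_sum_Sum by simp
  then show ?thesis
    by (simp add: pair_mult_def word_mult_def frag_extend_frag_sum frag_sum_Sum)
qed

lemma in_interleavings:
  "zs \<in># interleavings xs ys \<Longrightarrow> length zs = length xs + length ys \<and> set zs = set xs \<union> set ys"
proof (induction xs ys arbitrary: zs rule: interleavings.induct)
  case (3 x xs y ys)
  then show ?case by fastforce
qed auto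

lemma in_pair_shuffle:
  "w \<in># pair_shuffle u v \<Longrightarrow>
     fst w \<in># interleavings (fst u) (fst v) \<and> snd w \<in># interleavings (snd u) (snd v)"
  by (auto simp: pair_shuffle_def)

text \<open>The exponential generating function of the words: it forgets the letters, keeps the
  lengths before and after r, and turns the interleaving product into multiplication.\<close>

definition pair_weight :: "real \<Rightarrow> word_pair multiset \<Rightarrow> real poly" where
  "pair_weight h M = (\<Sum>u\<in>#M. split_weight h (length (fst u)) (length (snd u)))"

lemma pair_weight_simps [simp]:
  "pair_weight h {#} = 0" "pair_weight h (M + N) = pair_weight h M + pair_weight h N"
  by (simp_all add: pair_weight_def)

lemma pair_weight_Sum: "pair_weight h (\<Sum>x\<in>#A. f x) = (\<Sum>x\<in>#A. pair_weight h (f x))"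
  by (induction A) simp_all

lemma pair_weight_pair_shuffle:
  "pair_weight h (pair_shuffle u v) =
     split_weight h (length (fst u)) (length (snd u)) *
     split_weight h (length (fst v)) (length (snd v))"
proof -
  let ?a = "length (fst u)" and ?b = "length (snd u)"
  let ?c = "length (fst v)" and ?d = "length (snd v)"
  have "pair_weight h (pair_shuffle u v) =
      (\<Sum>E\<in>#interleavings (fst u) (fst v). \<Sum>F\<in>#interleavings (snd u) (snd v).
        split_weight h (length E) (length F))"
    unfolding pair_shuffle_def pair_weight_Sum by (simp add: pair_weight_def)
  also have "\<dots> = (\<Sum>E\<in>#interleavings (fst u) (fst v). \<Sum>F\<in>#interleavings (snd u) (snd v).
        split_weight h (?a + ?c) (?b + ?d))"
    by (intro arg_cong[of _ _ sum_mset] image_mset_cong) (auto dest!: in_interleavings)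
  also have "\<dots> = (of_nat (?a + ?c choose ?a) * divpow [:h, -1:] (?a + ?c)) *
      (of_nat (?b + ?d choose ?b) * divpow pvar (?b + ?d))"
    by (simp add: sum_mset_constant size_interleavings split_weight_def)
  finally show ?thesis
    by (simp add: divpow_mult[symmetric] split_weight_def)
qed

lemma pair_weight_pair_mult: "pair_weight h (pair_mult M N) = pair_weight h M * pair_weight h N"
proof -
  have "pair_weight h (pair_mult M N) =
      (\<Sum>u\<in>#M. \<Sum>v\<in>#N. split_weight h (length (fst u)) (length (snd u)) *
        split_weight h (length (fst v)) (length (snd v)))"
    by (simp add: pair_mult_def pair_weight_Sum pair_weight_pair_shuffle)
  also have "\<dots> = pair_weight h M * pair_weight h N"
    unfolding pair_weight_def sum_mset_distrib_right by (simp only: sum_mset_distrib_left)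
  finally show ?thesis .
qed

text \<open>The common total length makes the weights comparable degree by degree; the letters later
  become the colors.\<close>

definition words_over :: "nat \<Rightarrow> nat set \<Rightarrow> word_pair multiset \<Rightarrow> bool" where
  "words_over n S M \<longleftrightarrow>
     (\<forall>(A, B)\<in>#M. length A + length B = n \<and> set A \<union> set B \<subseteq> S)"

lemma words_over_pair_mult:
  assumes "words_over a S M" "words_over b S N"
  shows "words_over (a + b) S (pair_mult M N)"
  unfolding words_over_def
proof (clarify)
  fix A B assume "(A, B) \<in># pair_mult M N"
  then obtain u v where uv: "u \<in># M" "v \<in># N" "(A, B) \<in># pair_shuffle u v"
    by (auto simp: pair_mult_def)
  have "length (fst u) + length (snd u) = a" "set (fst u) \<union> set (snd u) \<subseteq> S"
    "length (fst v) + length (snd v) = b" "set (fst v) \<union> set (snd v) \<subseteq> S"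
    using assms uv(1,2) by (auto simp: words_over_def split_beta)
  moreover have "length A = length (fst u) + length (fst v)" "set A = set (fst u) \<union> set (fst v)"
    "length B = length (snd u) + length (snd v)" "set B = set (snd u) \<union> set (snd v)"
    using in_pair_shuffle[OF uv(3)] by (auto dest!: in_interleavings)
  ultimately show "length A + length B = a + b \<and> set A \<union> set B \<subseteq> S" by auto
qed

definition iota_pairs :: "nat list \<Rightarrow> word_pair multiset" where
  "iota_pairs as = (\<Sum>k\<in>{0..length as}. {#(take k as, drop k as)#})"

lemma frag_sum_sum: "frag_sum (sum f A) = (\<Sum>x\<in>A. frag_sum (f x))"
  by (induction A rule: infinite_finite_induct) simp_all

lemma pair_weight_sum: "pair_weight h (sum f A) = (\<Sum>x\<in>A. pair_weight h (f x))"
  by (induction A rule: infinite_finite_induct) simp_all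

lemma frag_sum_iota_pairs: "frag_sum (iota_pairs as) = word_iota as"
  by (simp add: iota_pairs_def word_iota_def frag_sum_sum)

text \<open>The sum over all cuts of the word is the binomial expansion of (X + Y)^s / s! with X + Y
  = h, so y drops out.\<close>

lemma pair_weight_iota_pairs: "pair_weight h (iota_pairs as) = [:h ^ length as / fact (length as):]"
proof -
  have "pair_weight h (iota_pairs as) =
      (\<Sum>k\<in>{0..length as}. split_weight h k (length as - k))"
    unfolding iota_pairs_def pair_weight_sum
    by (intro sum.cong) (auto simp: pair_weight_def min_absorb2)
  then show ?thesis
    using split_weight_total[of h "length as"] by (simp add: atMost_atLeast0)
qed

lemma words_over_iota_pairs: "set as \<subseteq> S \<Longrightarrow> words_over (length as) S (iota_pairs as)"
proof -
  assume as: "set as \<subseteq> S"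
  have "length A + length B = length as \<and> set A \<union> set B \<subseteq> S"
    if AB: "(A, B) \<in># iota_pairs as" for A B
  proof -
    from AB obtain k where "A = take k as" "B = drop k as"
      by (auto simp: iota_pairs_def set_mset_sum)
    moreover from this have "set A \<union> set B = set as"
      by (metis append_take_drop_id set_append)
    ultimately show ?thesis using as by simp
  qed
  then show ?thesis by (auto simp: words_over_def)
qed

definition tuple_pairs :: "nat \<Rightarrow> (nat \<Rightarrow> nat) \<Rightarrow> word_pair multiset" where
  "tuple_pairs m s =
     foldr pair_mult (map (\<lambda>i. iota_pairs (replicate (s i) i)) [1..<m]) {#([], replicate (s m) m)#}"

lemma frag_sum_tuple_pairs:
  "frag_sum (tuple_pairs m s) =
     foldr (\<star>) (map (\<lambda>i. word_iota (replicate (s i) i)) [1..<m]) (frag_of ([], replicate (s m) m))"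
proof -
  have "frag_sum (foldr pair_mult (map f xs) z) =
      foldr (\<star>) (map (\<lambda>i. frag_sum (f i)) xs) (frag_sum z)" for f and xs :: "nat list" and z
    by (induction xs) (simp_all add: frag_sum_pair_mult)
  then show ?thesis by (simp add: tuple_pairs_def frag_sum_iota_pairs)
qed

lemma pair_weight_tuple_pairs:
  "pair_weight h (tuple_pairs m s) =
     smult (\<Prod>i=1..<m. h ^ s i / fact (s i)) (divpow pvar (s m))"
proof -
  have "pair_weight h (foldr pair_mult (map f xs) z) =
      (\<Prod>i\<leftarrow>xs. pair_weight h (f i)) * pair_weight h z" for f and xs :: "nat list" and z
    by (induction xs) (simp_all add: pair_weight_pair_mult mult.assoc)
  moreover have "(\<Prod>i\<leftarrow>xs. [:c i:]) = [:\<Prod>i\<leftarrow>xs. c i:]" for c :: "nat \<Rightarrow> real" and xs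
    by (induction xs) (simp_all add: one_pCons)
  moreover have "pair_weight h {#([], replicate (s m) m)#} = divpow pvar (s m)"
    by (simp add: pair_weight_def split_weight_def)
  ultimately show ?thesis
    by (simp add: tuple_pairs_def pair_weight_iota_pairs prod.distinct_set_conv_list[symmetric])
qed

lemma words_over_tuple_pairs:
  assumes "m \<ge> 1"
  shows "words_over (\<Sum>i=1..m. s i) {1..m} (tuple_pairs m s)"
proof -
  have "words_over ((\<Sum>i\<leftarrow>xs. s i) + s m) {1..m}
      (foldr pair_mult (map (\<lambda>i. iota_pairs (replicate (s i) i)) xs) {#([], replicate (s m) m)#})"
    if "set xs \<subseteq> {1..m}" for xs
    using that
  proof (induction xs)
    case Nil
    then show ?case using assms by (auto simp: words_over_def)
  next
    case (Cons i xs)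
    then have "words_over (length (replicate (s i) i)) {1..m} (iota_pairs (replicate (s i) i))"
      by (intro words_over_iota_pairs) auto
    from words_over_pair_mult[OF this Cons.IH] Cons.prems show ?case by (simp add: add.assoc)
  qed
  then have "words_over ((\<Sum>i\<leftarrow>[1..<m]. s i) + s m) {1..m} (tuple_pairs m s)"
    unfolding tuple_pairs_def by (rule meta_mp) auto
  moreover have "(\<Sum>i\<leftarrow>[1..<m]. s i) + s m = (\<Sum>i=1..m. s i)"
  proof -
    have "{1..m} = insert m {1..<m}" using assms by auto
    then show ?thesis by (simp add: sum.distinct_set_conv_list[symmetric])
  qed
  ultimately show ?thesis by simp
qed

definition S_pairs :: "nat \<Rightarrow> (nat \<Rightarrow> nat) \<Rightarrow> word_pair multiset" where
  "S_pairs m l = (\<Sum>s\<in>tuples m l. tuple_pairs m s)"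

lemma frag_sum_S_pairs: "frag_sum (S_pairs m l) = word_S m l"
  by (simp add: S_pairs_def word_S_def frag_sum_sum frag_sum_tuple_pairs)

lemma pair_weight_S_pairs: "pair_weight h (S_pairs m l) = tuple_poly h m l"
  by (simp add: S_pairs_def tuple_poly_def pair_weight_sum pair_weight_tuple_pairs)

lemma words_over_S_pairs:
  assumes "m \<ge> 1"
  shows "words_over (\<Sum>i=1..m. l i) {1..m} (S_pairs m l)"
proof -
  have "words_over (\<Sum>i=1..m. l i) {1..m} (tuple_pairs m s)" if "s \<in> tuples m l" for s
    using words_over_tuple_pairs[OF assms, of s] that by (simp add: tuples_def)
  then show ?thesis
    unfolding S_pairs_def words_over_def by (fastforce simp: finite_tuples set_mset_sum)
qed

section \<open>From generating functions to colorings\<close>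

lemma split_weight_coeffs_eq:
  assumes "\<And>h. (\<Sum>k\<le>n. of_nat (a k) * split_weight h k (n - k)) =
    (\<Sum>k\<le>n. of_nat (b k) * split_weight h k (n - k))" "k \<le> n"
  shows "a k = (b k :: nat)"
proof -
  let ?c = "\<lambda>k. 1 / (fact k * fact (n - k)) :: real"
  have "(\<Sum>k\<le>n. (real (a k) * ?c k) * z ^ k) = (\<Sum>k\<le>n. (real (b k) * ?c k) * z ^ k)" for z
    \<comment> \<open>At y = 1 and h = z + 1 one has X = z and Y = 1, so both sides become
      polynomials in z whose coefficients can be compared.\<close>
    using arg_cong[OF assms(1)[of "z + 1"], of "\<lambda>p. poly p 1"]
    by (simp add: poly_sum split_weight_def divpow_def mult_ac)
  then have "real (a k) * ?c k = real (b k) * ?c k"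
    using assms(2) polyfun_eq_coeffs[where n = n and c = "\<lambda>k. real (a k) * ?c k"
        and d = "\<lambda>k. real (b k) * ?c k"] by blast
  then show ?thesis by simp
qed

lemma ex_matching:
  assumes "finite X" "\<And>k. card {x \<in> X. p x = k} = size {#u \<in># M. q u = k#}"
  shows "\<exists>g. image_mset g (mset_set X) = M \<and> (\<forall>x\<in>X. q (g x) = p x)"
  using assms
proof (induction X arbitrary: M rule: finite_induct)
  case empty
  have "M = {#}"
  proof (rule ccontr)
    assume "M \<noteq> {#}"
    then obtain u where "u \<in># M" by blast
    then have "u \<in># {#v \<in># M. q v = q u#}" by simp
    moreover have "size {#v \<in># M. q v = q u#} = 0"
      unfolding empty[of "q u", symmetric] by simp
    then have "{#v \<in># M. q v = q u#} = {#}" by (rule size_eq_0_iff_empty[THEN iffD1])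
    ultimately show False by (simp only: set_mset_empty empty_iff)
  qed
  then show ?case by simp
next
  case (insert x X)
  have "card {y \<in> insert x X. p y = p x} \<noteq> 0" using insert.hyps by auto
  then have "size {#u \<in># M. q u = p x#} \<noteq> 0"
    unfolding insert.prems[of "p x"] .
  then have "{#u \<in># M. q u = p x#} \<noteq> {#}"
    unfolding size_eq_0_iff_empty .
  then obtain u where "u \<in># {#u \<in># M. q u = p x#}" by (rule multiset_nonemptyE)
  then have u: "u \<in># M" "q u = p x" by simp_all
  obtain N where N: "M = add_mset u N" using u(1) by (rule mset_add)
  have "card {y \<in> X. p y = k} = size {#v \<in># N. q v = k#}" for k
  proof -
    have "{y \<in> insert x X. p y = k} = (if p x = k then insert x {y \<in> X. p y = k} else {y \<in> X. p y = k})"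
      by auto
    then have "card {y \<in> insert x X. p y = k} = (if p x = k then 1 else 0) + card {y \<in> X. p y = k}"
      using insert.hyps by simp
    then show ?thesis using insert.prems[of k] u(2) by (cases "p x = k") (simp_all add: N)
  qed
  from insert.IH[OF this] obtain g where g: "image_mset g (mset_set X) = N"
      "\<forall>x\<in>X. q (g x) = p x" by blast
  have "image_mset (g(x := u)) (mset_set X) = image_mset g (mset_set X)"
    using insert.hyps by (intro image_mset_cong) auto
  then have "image_mset (g(x := u)) (mset_set (insert x X)) = M"
    using insert.hyps by (simp add: g(1) N fun_upd_same del: fun_upd_apply)
  moreover have "\<forall>y\<in>insert x X. q ((g(x := u)) y) = p y"
    using g(2) u(2) by simp
  ultimately show ?case by blast
qed

lemma root_pos_le:
  assumes "(\<sigma>, R) \<in> ordered_pairings e" "set e \<subseteq> {1, -1}" "length e = 2 * n"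
  obtains A B where "increasing_list (tree_verts e \<sigma>) R = A @ tree_root e \<sigma> # B"
    "distinct (A @ tree_root e \<sigma> # B)" "length A = root_pos e (\<sigma>, R)" "length A + length B = n"
    "tree_verts e \<sigma> = insert (tree_root e \<sigma>) (set A \<union> set B)"
proof -
  let ?xs = "increasing_list (tree_verts e \<sigma>) R"
  have "strict_linear_order_on (tree_verts e \<sigma>) R"
    using assms(1) by (simp add: ordered_pairings_def compatible_order_def)
  note xs = increasing_list(1,2)[OF finite_tree_verts this]
  have "tree_root e \<sigma> \<in> set ?xs" using xs(1) tree_root_in_tree_verts by simp
  then obtain A B where AB: "?xs = A @ tree_root e \<sigma> # B" by (meson split_list)
  then have "tree_root e \<sigma> \<notin> set A" using xs(2) by simp
  then have "length A = root_pos e (\<sigma>, R)" by (simp add: root_pos_def AB takeWhile_append)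
  moreover have "length A + length B = n"
    using length_increasing_list[OF assms(1,2)] assms(3) by (simp add: AB)
  ultimately show thesis using that AB xs by (metis (no_types, lifting) Un_insert_right list.simps(15) set_append)
qed

lemma ex_coloring:
  assumes "(\<sigma>, R) \<in> ordered_pairings e" "set e \<subseteq> {1, -1}" "length e = 2 * n"
    and "length C = root_pos e (\<sigma>, R)" "length C + length D = n"
  shows "\<exists>f. tree_word e \<sigma> R f = frag_of (C, D) \<and>
    (\<forall>v\<in>tree_verts e \<sigma> - {tree_root e \<sigma>}. f v \<in> set C \<union> set D)"
proof -
  obtain A B where AB: "increasing_list (tree_verts e \<sigma>) R = A @ tree_root e \<sigma> # B"
    "distinct (A @ tree_root e \<sigma> # B)" "length A = root_pos e (\<sigma>, R)" "length A + length B = n"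
    "tree_verts e \<sigma> = insert (tree_root e \<sigma>) (set A \<union> set B)"
    using root_pos_le[OF assms(1-3)] by blast
  have len: "length A = length C" "length B = length D" using AB assms by simp_all
  \<comment> \<open>The vertices other than the root are distinct, so they can take the letters of
    \<open>C\<close> and \<open>D\<close> in their order.\<close>
  define f where "f v = the (map_of (zip (A @ B) (C @ D)) v)" for v
  have "map f (A @ B) = C @ D"
  proof (rule nth_equalityI)
    fix i assume "i < length (map f (A @ B))"
    then have "i < length (A @ B)" by simp
    moreover have "distinct (A @ B)" using AB(2) by auto
    ultimately show "map f (A @ B) ! i = (C @ D) ! i"
      using len by (simp add: f_def map_of_zip_nth del: zip_append map_append)
  qed (simp add: len)
  then have f: "map f A = C" "map f B = D" using len by simp_all
  have "tree_root e \<sigma> \<notin> set A" using AB(2) by simp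
  then have "tree_word e \<sigma> R f = frag_of (C, D)"
    by (simp add: tree_word_def Let_def AB(1) takeWhile_append dropWhile_append f)
  moreover have "f v \<in> set C \<union> set D" if "v \<in> set A \<union> set B" for v
    using that f by auto
  ultimately show ?thesis using AB(5) by auto
qed

lemma set_eps_seq: "set (eps_seq m l) \<subseteq> {1, -1}"
  by (induction m) (auto simp: eps_seq_0 eps_seq_Suc set_replicate_conv_if)

lemma sum_split_weight_by_length:
  assumes "\<And>u. u \<in># M \<Longrightarrow> length (fst u) + length (snd u) = n"
  shows "(\<Sum>u\<in>#M. split_weight h (length (fst u)) (length (snd u))) =
    (\<Sum>k\<le>n. of_nat (size {#u \<in># M. length (fst u) = k#}) * split_weight h k (n - k))"
  using assms
proof (induction M)
  case (add u M)
  let ?p = "length (fst u)"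
  have u: "length (snd u) = n - ?p" "?p \<le> n" using add.prems[of u] by auto
  have "(\<Sum>k\<le>n. of_nat (size {#v \<in># add_mset u M. length (fst v) = k#}) * split_weight h k (n - k)) =
      (\<Sum>k\<le>n. (if ?p = k then split_weight h k (n - k) else 0) +
        of_nat (size {#v \<in># M. length (fst v) = k#}) * split_weight h k (n - k))"
    by (intro sum.cong) (auto simp: algebra_simps)
  also have "\<dots> = split_weight h ?p (n - ?p) +
      (\<Sum>k\<le>n. of_nat (size {#v \<in># M. length (fst v) = k#}) * split_weight h k (n - k))"
    using u(2) by (simp add: sum.distrib)
  finally show ?case using add u(1) by simp
qed simp

theorem mainTheorem6:
  fixes m :: nat and l :: "nat \<Rightarrow> nat"
  assumes "m \<ge> 1" and "mono_on {1..m} l"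
  shows "\<exists>\<kappa> :: nat set set \<Rightarrow> (nat set) rel \<Rightarrow> nat set \<Rightarrow> nat.
    (\<forall>(\<sigma>, R)\<in>ordered_pairings (eps_seq m l).
       \<forall>v\<in>tree_verts (eps_seq m l) \<sigma> - {tree_root (eps_seq m l) \<sigma>}. \<kappa> \<sigma> R v \<in> {1..m}) \<and>
    (\<Sum>(\<sigma>, R)\<in>ordered_pairings (eps_seq m l). tree_word (eps_seq m l) \<sigma> R (\<kappa> \<sigma> R)) = word_S m l"
proof -
  define e where "e = eps_seq m l"
  define n where "n = (\<Sum>i=1..m. l i)"
  define M where "M = S_pairs m l"
  let ?X = "ordered_pairings e"
  have e: "set e \<subseteq> {1, -1}" "length e = 2 * n"
    by (simp_all only: e_def n_def set_eps_seq length_eps_seq)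
  have M: "length A + length B = n" "set A \<union> set B \<subseteq> {1..m}" if "(A, B) \<in># M" for A B
    using words_over_S_pairs[OF assms(1), of l] that by (auto simp: M_def n_def words_over_def)
  have pos_le: "root_pos e x \<le> n" if "x \<in> ?X" for x
  proof -
    obtain \<sigma> R where x: "x = (\<sigma>, R)" by (cases x)
    show ?thesis
      by (rule root_pos_le[OF that[unfolded x] e]) (simp add: x)
  qed
  let ?a = "\<lambda>k. card {x \<in> ?X. root_pos e x = k}"
  let ?b = "\<lambda>k. size {#u \<in># M. length (fst u) = k#}"
  \<comment> \<open>Both sides are the generating polynomial by root position: one for ordered
    pairings, the other for the words in S.\<close>
  have weights_eq: "(\<Sum>k\<le>n. of_nat (?a k) * split_weight h k (n - k)) =
      (\<Sum>k\<le>n. of_nat (?b k) * split_weight h k (n - k))" for h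
  proof -
    have "(\<Sum>k\<le>n. of_nat (?a k) * split_weight h k (n - k)) =
        (\<Sum>k\<le>n. \<Sum>x | x \<in> ?X \<and> root_pos e x = k. split_weight h (root_pos e x) (n - root_pos e x))"
      by (intro sum.cong) auto
    also have "\<dots> = (\<Sum>x\<in>?X. split_weight h (root_pos e x) (n - root_pos e x))"
      by (rule sum.group) (use pos_le finite_ordered_pairings in auto)
    also have "\<dots> = tuple_poly h m l"
      using sum_ordered_pairings[OF e] word_volume_eps_seq[OF assms] by (simp add: e_def)
    also have "\<dots> = (\<Sum>u\<in>#M. split_weight h (length (fst u)) (length (snd u)))"
      by (simp add: M_def pair_weight_S_pairs[symmetric] pair_weight_def)
    also have "\<dots> = (\<Sum>k\<le>n. of_nat (?b k) * split_weight h k (n - k))"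
      using M(1) by (intro sum_split_weight_by_length) (auto simp: split_beta)
    finally show ?thesis .
  qed
  have counts_eq: "?a k = ?b k" for k
  proof (cases "k \<le> n")
    case True
    then show ?thesis by (rule split_weight_coeffs_eq[where a = ?a and b = ?b, OF weights_eq])
  next
    case that: False
    have "{x \<in> ?X. root_pos e x = k} = {}" using pos_le that by auto
    moreover have "{#u \<in># M. length (fst u) = k#} = {#}"
      unfolding set_mset_eq_empty_iff[symmetric] using M(1) that by force
    ultimately show ?thesis by (simp only: card.empty size_empty)
  qed
  \<comment> \<open>Words are distributed among the ordered pairings so that each word has as many
    letters before r as the tree has vertices below the root.\<close>
  obtain g where g: "image_mset g (mset_set ?X) = M"
      "\<forall>x\<in>?X. length (fst (g x)) = root_pos e x"
    using ex_matching[where p = "root_pos e" and q = "\<lambda>u. length (fst u)",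
        OF finite_ordered_pairings counts_eq] by blast
  have gM: "g x \<in># M" if "x \<in> ?X" for x
    using that finite_ordered_pairings[of e] unfolding g(1)[symmetric] by simp
  have "\<forall>x\<in>?X. \<exists>f. tree_word e (fst x) (snd x) f = frag_of (g x) \<and>
      (\<forall>v\<in>tree_verts e (fst x) - {tree_root e (fst x)}. f v \<in> {1..m})"
  proof
    fix x assume x_in: "x \<in> ?X"
    obtain \<sigma> R where x: "x = (\<sigma>, R)" by (cases x)
    obtain A B where AB: "g x = (A, B)" by (cases "g x")
    have A: "length A = root_pos e (\<sigma>, R)"
      using g(2) x_in AB x by auto
    have "(A, B) \<in># M" using gM[OF x_in] AB by simp
    note AB_M = M[OF this]
    obtain f where "tree_word e \<sigma> R f = frag_of (A, B)"
        "\<forall>v\<in>tree_verts e \<sigma> - {tree_root e \<sigma>}. f v \<in> set A \<union> set B"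
      using ex_coloring[OF x_in[unfolded x] e A AB_M(1)] by blast
    moreover from this AB_M(2) have "\<forall>v\<in>tree_verts e \<sigma> - {tree_root e \<sigma>}. f v \<in> {1..m}"
      by blast
    ultimately show "\<exists>f. tree_word e (fst x) (snd x) f = frag_of (g x) \<and>
        (\<forall>v\<in>tree_verts e (fst x) - {tree_root e (fst x)}. f v \<in> {1..m})"
      using AB unfolding x fst_conv snd_conv by (intro exI[of _ f] conjI) simp_all
  qed
  from bchoice[OF this] obtain F where F: "\<forall>x\<in>?X.
      tree_word e (fst x) (snd x) (F x) = frag_of (g x) \<and>
      (\<forall>v\<in>tree_verts e (fst x) - {tree_root e (fst x)}. F x v \<in> {1..m})" ..
  define \<kappa> where "\<kappa> \<sigma> R = F (\<sigma>, R)" for \<sigma> R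
  have "(\<Sum>(\<sigma>, R)\<in>?X. tree_word e \<sigma> R (\<kappa> \<sigma> R)) = (\<Sum>x\<in>?X. frag_of (g x))"
    using F by (intro sum.cong) (auto simp: \<kappa>_def)
  also have "\<dots> = frag_sum (image_mset g (mset_set ?X))"
    by (simp add: frag_sum_def sum_unfold_sum_mset image_mset.compositionality comp_def)
  also have "\<dots> = word_S m l" by (simp add: g(1) M_def frag_sum_S_pairs)
  finally have "(\<Sum>(\<sigma>, R)\<in>?X. tree_word e \<sigma> R (\<kappa> \<sigma> R)) = word_S m l" .
  moreover have "\<forall>(\<sigma>, R)\<in>?X. \<forall>v\<in>tree_verts e \<sigma> - {tree_root e \<sigma>}. \<kappa> \<sigma> R v \<in> {1..m}"
    using F by (simp add: \<kappa>_def split_beta)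
  ultimately show ?thesis unfolding e_def by blast
qed

end
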